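(* Let $H$ be a self-adjoint operator on $L^2(\mathbf{R}^d,dx)$, bounded from below and satisfying assumptions (a)--(d) of the context, with ground state $\varphi_0$ and with $t_{\rm b}$ as in (d). The following hold. (i) If the semigroup $\{e^{-tH}: t \geq 0\}$ is IHC and there exists $\delta \in (0,1)$ such that $\varphi_0^{1-\delta} \in L^1(\mathbf{R}^d,dx)$, then for every $p \in (2,\infty)$ the semigroup $\{e^{-tH}: t \geq 0\}$ is $L^p$-AGSD. Specifically (for such $\delta$), if for every $p \in (2,\infty)$ there exists $t_p>0$ such that for all $t \geq t_p$ the operators $e^{-t\widetilde{H}}$ are bounded from $L^2(\mathbf{R}^d,\mu)$ to $L^p(\mathbf{R}^d,\mu)$, then for every $p \in (2,\infty)$ the semigroup $\{e^{-tH}: t \geq 0\}$ is $\big(2\max(t_p, t_{p_{\delta}}),L^p\big)$-AGSD, where $p_{\delta} = 1+ 1/\delta$. (ii) If for every $p \in (2,\infty)$ the semigroup $\{e^{-tH}: t \geq 0\}$ is $L^p$-AGSD, then the semigroup $\{e^{-tH}: t \geq 0\}$ is IHC. Specifically, if for every $p \in (2,\infty)$ there exists $t_p>0$ such that for all $t \geq t_p$ the operators $e^{-tH}$ are $L^p$-GSD, then for every $p \in (2,\infty)$ and all $t \geq t_{\rm b}+t_p$ the operators $e^{-t\widetilde{H}}$ are bounded from $L^2(\mathbf{R}^d,\mu)$ to $L^p(\mathbf{R}^d,\mu)$.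
   Context: Setting: $H$ is a self-adjoint operator on $L^2(\mathbf{R}^d,dx)$, bounded from below, such that: (a) $\lambda_0:=\inf\mathrm{Spec}\, H$ is a non-degenerate eigenvalue; (b) $e^{-tH}$ is positivity improving for every $t>0$, i.e. $e^{-tH} f > 0$ on $\mathbf{R}^d$ (as an element of $L^2$) for every $f \in L^2(\mathbf{R}^d,dx)$ with $f \geq 0$ a.e. and $f$ not a.e. zero; (c) $e^{-tH}$ is bounded on $L^{\infty}(\mathbf{R}^d,dx)$ for all $t > 0$, and $|e^{-tH} f(x)| \leq e^{-tH} \mathbf{1}(x) \|f\|_{\infty}$ for a.e. $x \in \mathbf{R}^d$ and every $f \in L^{\infty}(\mathbf{R}^d,dx)$; (d) there exists $t_{\rm b} >0$ such that $e^{-t_{\rm b} H}$ is bounded from $L^2(\mathbf{R}^d,dx)$ to $L^{\infty}(\mathbf{R}^d,dx)$. Here $\mathbf{1}$ is the constant function $1$ on $\mathbf{R}^d$, and the action of $e^{-tH}$ on $L^\infty$ is the extension of the $L^2$ action by monotone limits: $e^{-tH}f=\lim_{n} e^{-tH}(f\mathbf{1}_{B(0,n)})$ a.e. for $0\le f\in L^\infty$, extended linearly. The ground state $\varphi_0$ is the $L^2$-normalized, strictly positive eigenfunction of $H$ for the eigenvalue $\lambda_0$ (it lies in $L^\infty$). Put $\mu(dx)=\varphi_0^2(x)dx$, a probability measure. The ground state-transformed semigroup is $$e^{-t\widetilde{H}} f(x) = \frac{e^{\lambda_0 t}}{\varphi_0(x)} e^{-tH}(f \varphi_0)(x), \quad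 f \in L^2(\mathbf{R}^d, \mu),\ t \geq 0.$$ Definitions, for $p\in(2,\infty)$: - The operator $e^{-tH}$ is $L^p$-GSD ($L^p$-ground state dominated) if $\frac{e^{-tH}\mathbf{1}}{\varphi_0}\in L^p(\mathbf{R}^d,\mu)$. - For $t_p>0$, the semigroup $\{e^{-tH}:t\ge0\}$ is $(t_p,L^p)$-AGSD if $e^{-tH}$ is $L^p$-GSD for every $t>t_p$; it is $L^p$-AGSD (asymptotically $L^p$-ground state dominated) if it is $(t_p,L^p)$-AGSD for some $t_p>0$. - The semigroup $\{e^{-tH}:t\ge0\}$ is IHC (intrinsically hypercontractive) if for every $p\in(2,\infty)$ there exists $t_p>0$ such that for every $t\ge t_p$ the operator $e^{-t\widetilde H}$ is bounded from $L^2(\mathbf{R}^d,\mu)$ to $L^p(\mathbf{R}^d,\mu)$. *)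

theory Defs
  imports "HOL-Probability.Probability"
begin

text \<open>
  Elements of the complex Lebesgue spaces are represented by Borel measurable functions; equality of
  elements is equality almost everywhere.
\<close>

definition Lp_space :: "'a measure \<Rightarrow> real \<Rightarrow> ('a \<Rightarrow> complex) set" where
  "Lp_space M p = {f \<in> borel_measurable M. integrable M (\<lambda>x. cmod (f x) powr p)}"

definition Lp_norm :: "'a measure \<Rightarrow> real \<Rightarrow> ('a \<Rightarrow> complex) \<Rightarrow> real" where
  "Lp_norm M p f = (LINT x|M. cmod (f x) powr p) powr (1 / p)"

definition Linf_space :: "'a measure \<Rightarrow> ('a \<Rightarrow> complex) set" where
  "Linf_space M = {f \<in> borel_measurable M. esssup M (\<lambda>x. ereal (cmod (f x))) < \<infinity>}"

definition Linf_norm :: "'a measure \<Rightarrow> ('a \<Rightarrow> complex) \<Rightarrow> real" where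
  "Linf_norm M f = real_of_ereal (esssup M (\<lambda>x. ereal (cmod (f x))))"

definition bounded_from_to ::
  "('a \<Rightarrow> complex) set \<Rightarrow> (('a \<Rightarrow> complex) \<Rightarrow> real) \<Rightarrow> ('a \<Rightarrow> complex) set \<Rightarrow> (('a \<Rightarrow> complex) \<Rightarrow> real)
    \<Rightarrow> (('a \<Rightarrow> complex) \<Rightarrow> ('a \<Rightarrow> complex)) \<Rightarrow> bool" where
  "bounded_from_to V nV W nW S \<longleftrightarrow> (\<exists>C. \<forall>f\<in>V. S f \<in> W \<and> nW (S f) \<le> C * nV f)"

type_synonym 'd cfun = "real^'d \<Rightarrow> complex"

abbreviation L2 :: "'d::finite cfun set" where "L2 \<equiv> Lp_space lborel 2"
abbreviation L2_norm :: "'d::finite cfun \<Rightarrow> real" where "L2_norm \<equiv> Lp_norm lborel 2"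
abbreviation Linf :: "'d::finite cfun set" where "Linf \<equiv> Linf_space lborel"
abbreviation Linf_nrm :: "'d::finite cfun \<Rightarrow> real" where "Linf_nrm \<equiv> Linf_norm lborel"

definition ae_eq :: "'d::finite cfun \<Rightarrow> 'd cfun \<Rightarrow> bool" where
  "ae_eq f g \<longleftrightarrow> (AE x in lborel. f x = g x)"

definition L2_inner :: "'d::finite cfun \<Rightarrow> 'd cfun \<Rightarrow> complex" where
  "L2_inner f g = (LINT x|lborel. f x * cnj (g x))"

section \<open>Unbounded operators\<close>

text \<open>
  An operator is a domain \<open>D\<close> together with a map \<open>H\<close>, whose values outside \<open>D\<close> are irrelevant.
  The first two clauses say that both are well defined on classes modulo equality almost everywhere.
\<close>

definition linear_operator :: "'d::finite cfun set \<Rightarrow> ('d cfun \<Rightarrow> 'd cfun) \<Rightarrow> bool" where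
  "linear_operator D H \<longleftrightarrow>
     D \<subseteq> L2 \<and> H ` D \<subseteq> L2 \<and>
     (\<forall>f\<in>D. \<forall>g\<in>L2. ae_eq f g \<longrightarrow> g \<in> D \<and> ae_eq (H f) (H g)) \<and>
     (\<lambda>x. 0) \<in> D \<and>
     (\<forall>f\<in>D. \<forall>g\<in>D. (\<lambda>x. f x + g x) \<in> D \<and> ae_eq (H (\<lambda>x. f x + g x)) (\<lambda>x. H f x + H g x)) \<and>
     (\<forall>f\<in>D. \<forall>c. (\<lambda>x. c * f x) \<in> D \<and> ae_eq (H (\<lambda>x. c * f x)) (\<lambda>x. c * H f x))"

definition densely_defined :: "'d::finite cfun set \<Rightarrow> bool" where
  "densely_defined D \<longleftrightarrow> (\<forall>f\<in>L2. \<forall>\<epsilon>>0. \<exists>g\<in>D. L2_norm (\<lambda>x. f x - g x) < \<epsilon>)"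

definition adjoint_graph ::
  "'d::finite cfun set \<Rightarrow> ('d cfun \<Rightarrow> 'd cfun) \<Rightarrow> ('d cfun \<times> 'd cfun) set" where
  "adjoint_graph D H =
     {(g, h). g \<in> L2 \<and> h \<in> L2 \<and> (\<forall>f\<in>D. L2_inner (H f) g = L2_inner f h)}"

definition self_adjoint :: "'d::finite cfun set \<Rightarrow> ('d cfun \<Rightarrow> 'd cfun) \<Rightarrow> bool" where
  "self_adjoint D H \<longleftrightarrow>
     linear_operator D H \<and> densely_defined D \<and>
     adjoint_graph D H = {(g, h). g \<in> D \<and> h \<in> L2 \<and> ae_eq h (H g)}"

definition bounded_from_below :: "'d::finite cfun set \<Rightarrow> ('d cfun \<Rightarrow> 'd cfun) \<Rightarrow> bool" where
  "bounded_from_below D H \<longleftrightarrow> (\<exists>c. \<forall>f\<in>D. Re (L2_inner (H f) f) \<ge> c * (L2_norm f)\<^sup>2)"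

definition resolvent_set :: "'d::finite cfun set \<Rightarrow> ('d cfun \<Rightarrow> 'd cfun) \<Rightarrow> complex set" where
  "resolvent_set D H = {z.
     (\<forall>f\<in>D. ae_eq (\<lambda>x. H f x - z * f x) (\<lambda>x. 0) \<longrightarrow> ae_eq f (\<lambda>x. 0)) \<and>
     (\<exists>C. \<forall>g\<in>L2. \<exists>f\<in>D. ae_eq (\<lambda>x. H f x - z * f x) g \<and> L2_norm f \<le> C * L2_norm g)}"

definition spectrum :: "'d::finite cfun set \<Rightarrow> ('d cfun \<Rightarrow> 'd cfun) \<Rightarrow> complex set" where
  "spectrum D H = - resolvent_set D H"

text \<open>Intended for self-adjoint operators, whose spectrum is real.\<close>

definition inf_spectrum :: "'d::finite cfun set \<Rightarrow> ('d cfun \<Rightarrow> 'd cfun) \<Rightarrow> real" where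
  "inf_spectrum D H = Inf {r. complex_of_real r \<in> spectrum D H}"

definition eigenspace :: "'d::finite cfun set \<Rightarrow> ('d cfun \<Rightarrow> 'd cfun) \<Rightarrow> complex \<Rightarrow> 'd cfun set" where
  "eigenspace D H z = {f \<in> D. ae_eq (H f) (\<lambda>x. z * f x)}"

definition nondegenerate_eigenvalue ::
  "'d::finite cfun set \<Rightarrow> ('d cfun \<Rightarrow> 'd cfun) \<Rightarrow> complex \<Rightarrow> bool" where
  "nondegenerate_eigenvalue D H z \<longleftrightarrow>
     (\<exists>f\<in>eigenspace D H z. \<not> ae_eq f (\<lambda>x. 0) \<and>
        (\<forall>g\<in>eigenspace D H z. \<exists>c. ae_eq g (\<lambda>x. c * f x)))"

section \<open>The semigroup and its action on bounded functions\<close>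

definition C0_semigroup :: "(real \<Rightarrow> 'd::finite cfun \<Rightarrow> 'd cfun) \<Rightarrow> bool" where
  "C0_semigroup T \<longleftrightarrow>
     (\<forall>t\<ge>0. linear_operator L2 (T t) \<and> bounded_from_to L2 L2_norm L2 L2_norm (T t)) \<and>
     (\<forall>f\<in>L2. ae_eq (T 0 f) f) \<and>
     (\<forall>s\<ge>0. \<forall>t\<ge>0. \<forall>f\<in>L2. ae_eq (T (s + t) f) (T s (T t f))) \<and>
     (\<forall>f\<in>L2. ((\<lambda>t. L2_norm (\<lambda>x. T t f x - f x)) \<longlongrightarrow> 0) (at_right 0))"

text \<open>
  \<open>T t\<close> is the operator \<open>exp (- t H)\<close>: for \<open>H\<close> self-adjoint and bounded from below, the strongly continuous
  semigroup with infinitesimal generator \<open>- H\<close> (with its exact domain) exists and is unique up to the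
  choice of representatives.
\<close>

definition exp_semigroup ::
  "'d::finite cfun set \<Rightarrow> ('d cfun \<Rightarrow> 'd cfun) \<Rightarrow> (real \<Rightarrow> 'd cfun \<Rightarrow> 'd cfun) \<Rightarrow> bool" where
  "exp_semigroup D H T \<longleftrightarrow>
     C0_semigroup T \<and>
     (\<forall>f\<in>L2. \<forall>g\<in>L2.
        ((\<lambda>t. L2_norm (\<lambda>x. (T t f x - f x) / complex_of_real t - g x)) \<longlongrightarrow> 0) (at_right 0)
        \<longleftrightarrow> f \<in> D \<and> ae_eq g (\<lambda>x. - H f x))"

definition positivity_improving :: "('d::finite cfun \<Rightarrow> 'd cfun) \<Rightarrow> bool" where
  "positivity_improving S \<longleftrightarrow>
     (\<forall>f\<in>L2. (AE x in lborel. f x \<in> \<real>\<^sub>\<ge>\<^sub>0) \<longrightarrow> \<not> ae_eq f (\<lambda>x. 0) \<longrightarrow>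
        (AE x in lborel. S f x \<in> \<real>\<^sub>\<ge>\<^sub>0 - {0}))"

definition cut_off :: "nat \<Rightarrow> 'd::finite cfun \<Rightarrow> 'd cfun" where
  "cut_off n f = (\<lambda>x. f x * indicator (ball 0 (real n)) x)"

definition monotone_ext :: "('d::finite cfun \<Rightarrow> 'd cfun) \<Rightarrow> 'd cfun \<Rightarrow> 'd cfun" where
  "monotone_ext S f = (\<lambda>x. lim (\<lambda>n. S (cut_off n f) x))"

text \<open>
  Linear extension of \<open>monotone_ext S\<close> from nonnegative to complex functions, by means of positive
  and negative parts of real and imaginary part.
\<close>

definition Linf_ext :: "('d::finite cfun \<Rightarrow> 'd cfun) \<Rightarrow> 'd cfun \<Rightarrow> 'd cfun" where
  "Linf_ext S f = (\<lambda>x.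
       monotone_ext S (\<lambda>y. complex_of_real (max 0 (Re (f y)))) x
     - monotone_ext S (\<lambda>y. complex_of_real (max 0 (- Re (f y)))) x
     + \<i> * monotone_ext S (\<lambda>y. complex_of_real (max 0 (Im (f y)))) x
     - \<i> * monotone_ext S (\<lambda>y. complex_of_real (max 0 (- Im (f y)))) x)"

text \<open>
  The limit defining the extension of a positivity preserving \<open>S\<close> is monotone, so it could a priori
  be infinite, where \<open>lim\<close> has no meaning; boundedness on the space of bounded functions therefore
  includes convergence of the limit.
\<close>

definition bounded_on_Linf :: "('d::finite cfun \<Rightarrow> 'd cfun) \<Rightarrow> bool" where
  "bounded_on_Linf S \<longleftrightarrow>
     (\<forall>f\<in>Linf. (AE x in lborel. f x \<in> \<real>\<^sub>\<ge>\<^sub>0) \<longrightarrow>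
        (AE x in lborel. convergent (\<lambda>n. S (cut_off n f) x))) \<and>
     bounded_from_to Linf Linf_nrm Linf Linf_nrm (Linf_ext S)"

section \<open>The standing assumptions\<close>

definition assumption_a :: "'d::finite cfun set \<Rightarrow> ('d cfun \<Rightarrow> 'd cfun) \<Rightarrow> bool" where
  "assumption_a D H \<longleftrightarrow> nondegenerate_eigenvalue D H (complex_of_real (inf_spectrum D H))"

definition assumption_b :: "(real \<Rightarrow> 'd::finite cfun \<Rightarrow> 'd cfun) \<Rightarrow> bool" where
  "assumption_b T \<longleftrightarrow> (\<forall>t>0. positivity_improving (T t))"

definition assumption_c :: "(real \<Rightarrow> 'd::finite cfun \<Rightarrow> 'd cfun) \<Rightarrow> bool" where
  "assumption_c T \<longleftrightarrow>
     (\<forall>t>0. bounded_on_Linf (T t) \<and>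
        (\<forall>f\<in>Linf. AE x in lborel.
           cmod (Linf_ext (T t) f x) \<le> Re (Linf_ext (T t) (\<lambda>y. 1) x) * Linf_nrm f))"

definition assumption_d :: "(real \<Rightarrow> 'd::finite cfun \<Rightarrow> 'd cfun) \<Rightarrow> real \<Rightarrow> bool" where
  "assumption_d T tb \<longleftrightarrow> tb > 0 \<and> bounded_from_to L2 L2_norm Linf Linf_nrm (T tb)"

section \<open>Ground state, ground state domination, intrinsic hypercontractivity\<close>

definition ground_state ::
  "'d::finite cfun set \<Rightarrow> ('d cfun \<Rightarrow> 'd cfun) \<Rightarrow> (real^'d \<Rightarrow> real) \<Rightarrow> bool" where
  "ground_state D H \<phi> \<longleftrightarrow>
     (\<lambda>x. complex_of_real (\<phi> x)) \<in> eigenspace D H (complex_of_real (inf_spectrum D H)) \<and>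
     L2_norm (\<lambda>x. complex_of_real (\<phi> x)) = 1 \<and>
     (AE x in lborel. \<phi> x > 0)"

definition gs_measure :: "(real^'d::finite \<Rightarrow> real) \<Rightarrow> (real^'d) measure" where
  "gs_measure \<phi> = density lborel (\<lambda>x. ennreal ((\<phi> x)\<^sup>2))"

definition gst_semigroup ::
  "(real \<Rightarrow> 'd::finite cfun \<Rightarrow> 'd cfun) \<Rightarrow> real \<Rightarrow> (real^'d \<Rightarrow> real) \<Rightarrow> real \<Rightarrow> 'd cfun \<Rightarrow> 'd cfun" where
  "gst_semigroup T lam0 \<phi> t f =
     (\<lambda>x. complex_of_real (exp (lam0 * t) / \<phi> x) * T t (\<lambda>y. f y * complex_of_real (\<phi> y)) x)"

definition gst_bounded ::
  "(real \<Rightarrow> 'd::finite cfun \<Rightarrow> 'd cfun) \<Rightarrow> real \<Rightarrow> (real^'d \<Rightarrow> real) \<Rightarrow> real \<Rightarrow> real \<Rightarrow> bool" where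
  "gst_bounded T lam0 \<phi> t p \<longleftrightarrow>
     bounded_from_to (Lp_space (gs_measure \<phi>) 2) (Lp_norm (gs_measure \<phi>) 2)
       (Lp_space (gs_measure \<phi>) p) (Lp_norm (gs_measure \<phi>) p) (gst_semigroup T lam0 \<phi> t)"

definition GSD :: "('d::finite cfun \<Rightarrow> 'd cfun) \<Rightarrow> (real^'d \<Rightarrow> real) \<Rightarrow> real \<Rightarrow> bool" where
  "GSD S \<phi> p \<longleftrightarrow>
     (\<lambda>x. Linf_ext S (\<lambda>y. 1) x / complex_of_real (\<phi> x)) \<in> Lp_space (gs_measure \<phi>) p"

definition AGSD_from ::
  "(real \<Rightarrow> 'd::finite cfun \<Rightarrow> 'd cfun) \<Rightarrow> (real^'d \<Rightarrow> real) \<Rightarrow> real \<Rightarrow> real \<Rightarrow> bool" where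
  "AGSD_from T \<phi> t\<^sub>p p \<longleftrightarrow> t\<^sub>p > 0 \<and> (\<forall>t>t\<^sub>p. GSD (T t) \<phi> p)"

definition AGSD ::
  "(real \<Rightarrow> 'd::finite cfun \<Rightarrow> 'd cfun) \<Rightarrow> (real^'d \<Rightarrow> real) \<Rightarrow> real \<Rightarrow> bool" where
  "AGSD T \<phi> p \<longleftrightarrow> (\<exists>t\<^sub>p. AGSD_from T \<phi> t\<^sub>p p)"

definition IHC ::
  "(real \<Rightarrow> 'd::finite cfun \<Rightarrow> 'd cfun) \<Rightarrow> real \<Rightarrow> (real^'d \<Rightarrow> real) \<Rightarrow> bool" where
  "IHC T lam0 \<phi> \<longleftrightarrow> (\<forall>p>2. \<exists>t\<^sub>p>0. \<forall>t\<ge>t\<^sub>p. gst_bounded T lam0 \<phi> t p)"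

end

theory Submission
  imports Defs
begin

text \<open>
  Write \<open>\<mu> = \<phi>\<^sup>2 dx\<close>.  Multiplication by \<open>\<phi>\<close> identifies \<open>L\<^sup>2(\<mu>)\<close> with \<open>L\<^sup>2(dx)\<close> and the ground state-transformed
  operator, up to the factor \<open>e\<^sup>\<lambda>\<^sup>t\<close>, with the following map: apply \<open>T t\<close> and divide the result by \<open>\<phi>\<close>.

  Domination implies hypercontractivity (\<open>GSD_imp_gst_bounded\<close>).  For \<open>g\<close> in \<open>L\<^sup>2(dx)\<close> the function \<open>T t\<^sub>b g\<close> is
  bounded by a multiple of the norm of \<open>g\<close>, hence \<open>\<bar>T (s + t\<^sub>b) g\<bar> = \<bar>T s (T t\<^sub>b g)\<bar> \<le> C \<parallel>g\<parallel> T s 1\<close>.  Division by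
  \<open>\<phi>\<close> leaves a multiple of \<open>T s 1 / \<phi>\<close>, which lies in \<open>L\<^sup>p(\<mu>)\<close>.  This uses that the action of \<open>T s\<close> on bounded
  functions, a pointwise limit, agrees on \<open>L\<^sup>2\<close> with \<open>T s\<close> itself (\<open>Linf_ext_L2\<close>).

  Hypercontractivity implies domination (\<open>gst_bounded_imp_GSD\<close>).  Split \<open>t = s + r\<close> into two halves.  It suffices that
  \<open>T r 1\<close> lies in \<open>L\<^sup>2(dx)\<close>, since \<open>T r 1 / \<phi>\<close> then lies in \<open>L\<^sup>2(\<mu>)\<close> and the transformed step of length \<open>s\<close> takes it
  to a multiple of \<open>T t 1 / \<phi>\<close> in \<open>L\<^sup>p(\<mu>)\<close>.  By duality, \<open>T r 1\<close> is in \<open>L\<^sup>2\<close> as soon as \<open>T r\<close> is bounded from \<open>L\<^sup>2\<close> to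
  \<open>L\<^sup>1\<close>.  This follows by pairing the transformed function, which is in \<open>L\<^sup>q(\<mu>)\<close> for \<open>q = 1 + 1/\<delta>\<close>, with \<open>1/\<phi>\<close>,
  which is in the dual space because \<open>\<integral> \<phi>\<^sup>-\<^sup>1\<^sup>-\<^sup>\<delta> d\<mu> = \<integral> \<phi>\<^sup>1\<^sup>-\<^sup>\<delta> dx\<close> (\<open>gst_bounded_imp_L1_bound\<close>).

  The duality needs the symmetry of \<open>T r\<close> (\<open>semigroup_symmetric\<close>), to be derived from the self-adjointness of
  the generator.  The argument compares \<open>T t\<close> on either side of the inner product by moving it across in \<open>n\<close> small steps,
  each costing \<open>o(1/n)\<close>; it needs that the operators \<open>T s\<close> are uniformly bounded for \<open>s \<le> t\<close>
  (\<open>semigroup_locally_bounded\<close>), which is deduced from strong continuity and positivity.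
\<close>

section \<open>Square-integrable functions\<close>

lemma L2_iff: "f \<in> Lp_space M 2 \<longleftrightarrow> f \<in> borel_measurable M \<and> integrable M (\<lambda>x. (cmod (f x))\<^sup>2)"
  by (simp add: Lp_space_def)

lemma L2_norm_eq: "Lp_norm M 2 f = sqrt (LINT x|M. (cmod (f x))\<^sup>2)"
  by (simp add: Lp_norm_def powr_half_sqrt)

lemma L2_norm_nonneg [simp]: "0 \<le> Lp_norm M 2 f"
  by (simp add: L2_norm_eq)

lemma L2_norm_sq: "(Lp_norm M 2 f)\<^sup>2 = (LINT x|M. (cmod (f x))\<^sup>2)"
  by (simp add: L2_norm_eq)

lemma nn_integral_L2_norm:
  "f \<in> Lp_space M 2 \<Longrightarrow> (\<integral>\<^sup>+x. ennreal ((cmod (f x))\<^sup>2) \<partial>M) = ennreal ((Lp_norm M 2 f)\<^sup>2)"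
  by (simp add: L2_norm_sq L2_iff nn_integral_eq_integral)

lemma L2_norm_cong_AE:
  assumes "f \<in> borel_measurable M" "g \<in> borel_measurable M" "AE x in M. f x = g x"
  shows "Lp_norm M 2 f = Lp_norm M 2 g"
  unfolding L2_norm_eq using assms by (intro arg_cong[where f=sqrt] integral_cong_AE) auto

lemma integrable_nonneg_bound:
  fixes h w :: "'a \<Rightarrow> real"
  assumes w: "integrable M w" and h: "h \<in> borel_measurable M"
    and nonneg: "\<And>x. 0 \<le> h x" and le: "\<And>x. h x \<le> w x"
  shows "integrable M h"
proof (rule Bochner_Integration.integrable_bound[OF w h])
  have "norm (h x) \<le> norm (w x)" for x
    using nonneg[of x] le[of x] by simp
  then show "AE x in M. norm (h x) \<le> norm (w x)" by blast
qed

lemma Lp_dominated: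
  assumes f: "f \<in> Lp_space M p" and g: "g \<in> borel_measurable M" and p: "0 < p" and C: "0 \<le> C"
    and le: "AE x in M. cmod (g x) \<le> C * cmod (f x)"
  shows "g \<in> Lp_space M p" "Lp_norm M p g \<le> C * Lp_norm M p f"
proof -
  have [measurable]: "f \<in> borel_measurable M" "g \<in> borel_measurable M"
    using f g by (simp_all add: Lp_space_def)
  have le': "AE x in M. cmod (g x) powr p \<le> C powr p * cmod (f x) powr p"
    using le
  proof eventually_elim
    case (elim x)
    then have "cmod (g x) powr p \<le> (C * cmod (f x)) powr p"
      using p by (intro powr_mono2) simp_all
    then show ?case using C by (simp add: powr_mult)
  qed
  have intf: "integrable M (\<lambda>x. C powr p * cmod (f x) powr p)"
    using f by (simp add: Lp_space_def)
  have intg: "integrable M (\<lambda>x. cmod (g x) powr p)"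
    by (rule Bochner_Integration.integrable_bound[OF intf]) (use le' in simp_all)
  then show "g \<in> Lp_space M p" by (simp add: Lp_space_def)
  have "(LINT x|M. cmod (g x) powr p) \<le> C powr p * (LINT x|M. cmod (f x) powr p)"
    using integral_mono_AE[OF intg intf le'] by simp
  then have "Lp_norm M p g \<le> (C powr p * (LINT x|M. cmod (f x) powr p)) powr (1 / p)"
    unfolding Lp_norm_def using p by (intro powr_mono2) (simp_all add: integral_nonneg_AE)
  also have "\<dots> = C * Lp_norm M p f"
    unfolding Lp_norm_def using p C by (simp add: powr_mult powr_powr integral_nonneg_AE)
  finally show "Lp_norm M p g \<le> C * Lp_norm M p f" .
qed

lemma L2_dominated:
  assumes "f \<in> Lp_space M 2" "g \<in> borel_measurable M" "AE x in M. cmod (g x) \<le> cmod (f x)"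
  shows "g \<in> Lp_space M 2" "Lp_norm M 2 g \<le> Lp_norm M 2 f"
  using Lp_dominated[of f M 2 g 1] assms by simp_all

lemma L2_zero [simp]: "(\<lambda>x. 0) \<in> Lp_space M 2" "Lp_norm M 2 (\<lambda>x. 0) = 0"
  by (simp_all add: L2_iff L2_norm_eq)

lemma L2_cmult:
  assumes "f \<in> Lp_space M 2"
  shows "(\<lambda>x. c * f x) \<in> Lp_space M 2"
  using assms by (auto simp: L2_iff norm_mult power_mult_distrib)

lemma L2_norm_cmult: "Lp_norm M 2 (\<lambda>x. c * f x) = cmod c * Lp_norm M 2 f"
  by (simp add: L2_norm_eq norm_mult power_mult_distrib real_sqrt_mult)

lemma L2_add:
  assumes "f \<in> Lp_space M 2" "g \<in> Lp_space M 2"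
  shows "(\<lambda>x. f x + g x) \<in> Lp_space M 2"
proof -
  have [measurable]: "f \<in> borel_measurable M" "g \<in> borel_measurable M"
    using assms by (auto simp: L2_iff)
  have le: "(cmod (f x + g x))\<^sup>2 \<le> 2 * (cmod (f x))\<^sup>2 + 2 * (cmod (g x))\<^sup>2" for x
  proof -
    have "(cmod (f x + g x))\<^sup>2 \<le> (cmod (f x) + cmod (g x))\<^sup>2"
      by (intro power_mono norm_triangle_ineq) simp
    also have "\<dots> \<le> 2 * (cmod (f x))\<^sup>2 + 2 * (cmod (g x))\<^sup>2"
      using sum_squares_bound[of "cmod (f x)" "cmod (g x)"] by (simp add: power2_sum)
    finally show ?thesis .
  qed
  have "integrable M (\<lambda>x. 2 * (cmod (f x))\<^sup>2 + 2 * (cmod (g x))\<^sup>2)"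
    using assms by (simp add: L2_iff)
  then have "integrable M (\<lambda>x. (cmod (f x + g x))\<^sup>2)"
    by (rule integrable_nonneg_bound) (use le in simp_all)
  then show ?thesis by (simp add: L2_iff)
qed

lemma L2_diff:
  assumes "f \<in> Lp_space M 2" "g \<in> Lp_space M 2"
  shows "(\<lambda>x. f x - g x) \<in> Lp_space M 2"
  using L2_add[OF assms(1) L2_cmult[OF assms(2), of "-1"]] by simp

lemma L2_Cauchy_Schwarz:
  assumes f: "f \<in> Lp_space M 2" and g: "g \<in> Lp_space M 2"
  shows "integrable M (\<lambda>x. cmod (f x) * cmod (g x))"
    and "(LINT x|M. cmod (f x) * cmod (g x)) \<le> Lp_norm M 2 f * Lp_norm M 2 g"
proof -
  have [measurable]: "f \<in> borel_measurable M" "g \<in> borel_measurable M"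
    using f g by (auto simp: L2_iff)
  have le: "cmod (f x) * cmod (g x) \<le> (cmod (f x))\<^sup>2 + (cmod (g x))\<^sup>2" for x
    using sum_squares_bound[of "cmod (f x)" "cmod (g x)"]
      mult_nonneg_nonneg[OF norm_ge_zero[of "f x"] norm_ge_zero[of "g x"]] by linarith
  have "integrable M (\<lambda>x. (cmod (f x))\<^sup>2 + (cmod (g x))\<^sup>2)"
    using f g by (simp add: L2_iff)
  then show int: "integrable M (\<lambda>x. cmod (f x) * cmod (g x))"
    by (rule integrable_nonneg_bound) (use le in simp_all)
  let ?I = "LINT x|M. cmod (f x) * cmod (g x)"
  have "ennreal (?I\<^sup>2) = (\<integral>\<^sup>+x. ennreal (cmod (f x)) * ennreal (cmod (g x)) \<partial>M)\<^sup>2"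
    using int by (simp add: nn_integral_eq_integral ennreal_power flip: ennreal_mult)
  also have "\<dots> \<le> (\<integral>\<^sup>+x. (ennreal (cmod (f x)))\<^sup>2 \<partial>M) * (\<integral>\<^sup>+x. (ennreal (cmod (g x)))\<^sup>2 \<partial>M)"
    by (rule Cauchy_Schwarz_nn_integral) auto
  also have "\<dots> = ennreal ((Lp_norm M 2 f * Lp_norm M 2 g)\<^sup>2)"
    using f g by (simp add: ennreal_power nn_integral_L2_norm power_mult_distrib flip: ennreal_mult)
  finally have "?I\<^sup>2 \<le> (Lp_norm M 2 f * Lp_norm M 2 g)\<^sup>2" by simp
  then show "?I \<le> Lp_norm M 2 f * Lp_norm M 2 g"
    by (rule power2_le_imp_le) simp
qed

lemma L2_triangle:
  assumes f: "f \<in> Lp_space M 2" and g: "g \<in> Lp_space M 2"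
  shows "Lp_norm M 2 (\<lambda>x. f x + g x) \<le> Lp_norm M 2 f + Lp_norm M 2 g"
proof -
  have "(cmod (f x + g x))\<^sup>2 \<le> (cmod (f x))\<^sup>2 + (cmod (g x))\<^sup>2 + 2 * (cmod (f x) * cmod (g x))" for x
  proof -
    have "(cmod (f x + g x))\<^sup>2 \<le> (cmod (f x) + cmod (g x))\<^sup>2"
      by (intro power_mono norm_triangle_ineq) simp
    then show ?thesis by (simp add: power2_sum)
  qed
  then have "(LINT x|M. (cmod (f x + g x))\<^sup>2)
      \<le> (LINT x|M. (cmod (f x))\<^sup>2 + (cmod (g x))\<^sup>2 + 2 * (cmod (f x) * cmod (g x)))"
    using f g L2_add[OF f g] L2_Cauchy_Schwarz(1)[OF f g]
    by (intro integral_mono) (simp_all add: L2_iff)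
  also have "\<dots> = (Lp_norm M 2 f)\<^sup>2 + (Lp_norm M 2 g)\<^sup>2 + 2 * (LINT x|M. cmod (f x) * cmod (g x))"
    using f g L2_Cauchy_Schwarz(1)[OF f g] by (simp add: L2_norm_sq L2_iff)
  also have "\<dots> \<le> (Lp_norm M 2 f + Lp_norm M 2 g)\<^sup>2"
    using L2_Cauchy_Schwarz(2)[OF f g] by (simp add: power2_sum)
  finally show ?thesis
    by (subst (asm) L2_norm_sq[symmetric]) (rule power2_le_imp_le, simp_all)
qed

text \<open>Fatou's lemma, applied to \<open>\<bar>F n - G\<bar>\<^sup>2\<close>, makes the limits in norm and almost everywhere agree.\<close>

lemma L2_limit_AE_unique:
  assumes F: "\<And>n. F n \<in> Lp_space M 2" and G: "G \<in> Lp_space M 2"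
    and lim: "(\<lambda>n. Lp_norm M 2 (\<lambda>x. F n x - G x)) \<longlonglongrightarrow> 0"
    and ae: "AE x in M. (\<lambda>n. F n x) \<longlonglongrightarrow> G' x"
  shows "AE x in M. G' x = G x"
proof -
  have [measurable]: "\<And>n. F n \<in> borel_measurable M" "G \<in> borel_measurable M"
    using F G by (auto simp: L2_iff)
  let ?d = "\<lambda>n x. ennreal ((cmod (F n x - G x))\<^sup>2)"
  have "(\<integral>\<^sup>+x. liminf (\<lambda>n. ?d n x) \<partial>M) \<le> liminf (\<lambda>n. \<integral>\<^sup>+x. ?d n x \<partial>M)"
    by (rule nn_integral_liminf) auto
  also have "\<dots> = liminf (\<lambda>n. ennreal ((Lp_norm M 2 (\<lambda>x. F n x - G x))\<^sup>2))"
    by (simp add: nn_integral_L2_norm[OF L2_diff[OF F G]])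
  also have "\<dots> = ennreal (0\<^sup>2)"
    by (intro lim_imp_Liminf tendsto_ennrealI tendsto_power lim) simp
  finally have "(\<integral>\<^sup>+x. liminf (\<lambda>n. ?d n x) \<partial>M) = 0" by simp
  then have "AE x in M. liminf (\<lambda>n. ?d n x) = 0"
    by (subst (asm) nn_integral_0_iff_AE) auto
  then show ?thesis using ae
  proof eventually_elim
    case (elim x)
    have "(\<lambda>n. ?d n x) \<longlonglongrightarrow> ennreal ((cmod (G' x - G x))\<^sup>2)"
      by (intro tendsto_ennrealI tendsto_power tendsto_norm tendsto_diff elim tendsto_const)
    then have "liminf (\<lambda>n. ?d n x) = ennreal ((cmod (G' x - G x))\<^sup>2)"
      by (intro lim_imp_Liminf) simp
    with elim(1) show ?case by simp
  qed
qed

text \<open>The pointwise limit dominates the sequence, as it does for monotone limits of nonnegative functions.\<close>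

lemma L2_dominated_convergence:
  assumes F: "\<And>n. F n \<in> borel_measurable M" and G: "G \<in> Lp_space M 2"
    and le: "\<And>n. AE x in M. cmod (F n x) \<le> cmod (G x)"
    and ae: "AE x in M. (\<lambda>n. F n x) \<longlonglongrightarrow> G x"
  shows "(\<lambda>n. Lp_norm M 2 (\<lambda>x. F n x - G x)) \<longlonglongrightarrow> 0"
proof -
  have [measurable]: "\<And>n. F n \<in> borel_measurable M" "G \<in> borel_measurable M"
    using F G by (auto simp: L2_iff)
  have "(\<lambda>n. LINT x|M. (cmod (F n x - G x))\<^sup>2) \<longlonglongrightarrow> (LINT x|M. 0)"
  proof (rule integral_dominated_convergence[where w="\<lambda>x. 4 * (cmod (G x))\<^sup>2"])
    show "integrable M (\<lambda>x. 4 * (cmod (G x))\<^sup>2)" using G by (simp add: L2_iff)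
    show "AE x in M. (\<lambda>n. (cmod (F n x - G x))\<^sup>2) \<longlonglongrightarrow> 0"
      using ae
    proof eventually_elim
      case (elim x)
      have "(\<lambda>n. (cmod (F n x - G x))\<^sup>2) \<longlonglongrightarrow> (cmod (G x - G x))\<^sup>2"
        by (intro tendsto_power tendsto_norm tendsto_diff elim tendsto_const)
      then show ?case by simp
    qed
    show "AE x in M. norm ((cmod (F n x - G x))\<^sup>2) \<le> 4 * (cmod (G x))\<^sup>2" for n
      using le[of n]
    proof eventually_elim
      case (elim x)
      have "cmod (F n x - G x) \<le> 2 * cmod (G x)"
        using norm_triangle_ineq4[of "F n x" "G x"] elim by simp
      then have "(cmod (F n x - G x))\<^sup>2 \<le> (2 * cmod (G x))\<^sup>2" by (rule power_mono) simp
      then show ?case by (simp add: power_mult_distrib)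
    qed
  qed auto
  then have "(\<lambda>n. sqrt (LINT x|M. (cmod (F n x - G x))\<^sup>2)) \<longlonglongrightarrow> sqrt 0"
    by (intro tendsto_real_sqrt) simp
  then show ?thesis by (simp add: L2_norm_eq)
qed

lemma borel_measurable_cnj [measurable (raw)]:
  "f \<in> borel_measurable M \<Longrightarrow> (\<lambda>x. cnj (f x)) \<in> borel_measurable M"
  by (rule measurable_compose[OF _ borel_measurable_continuous_onI]) (auto intro!: continuous_intros)

lemma L2_inner_integrable:
  assumes "f \<in> L2" "g \<in> L2"
  shows "integrable lborel (\<lambda>x. f x * cnj (g x))"
proof -
  have [measurable]: "f \<in> borel_measurable lborel" "g \<in> borel_measurable lborel"
    using assms by (auto simp: L2_iff)
  show ?thesis
    by (rule Bochner_Integration.integrable_bound[OF L2_Cauchy_Schwarz(1)[OF assms]])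
      (auto simp: norm_mult)
qed

lemma L2_inner_bound:
  assumes "f \<in> L2" "g \<in> L2"
  shows "cmod (L2_inner f g) \<le> L2_norm f * L2_norm g"
proof -
  have "cmod (L2_inner f g) \<le> (LINT x|lborel. cmod (f x) * cmod (g x))"
    unfolding L2_inner_def
    by (rule order_trans[OF integral_norm_bound]) (simp add: norm_mult)
  with L2_Cauchy_Schwarz(2)[OF assms] show ?thesis by simp
qed

lemma L2_inner_diff_left:
  assumes "f \<in> L2" "g \<in> L2" "h \<in> L2"
  shows "L2_inner (\<lambda>x. f x - g x) h = L2_inner f h - L2_inner g h"
  using assms by (simp add: L2_inner_def left_diff_distrib L2_inner_integrable)

lemma L2_inner_add_left:
  assumes "f \<in> L2" "g \<in> L2" "h \<in> L2"
  shows "L2_inner (\<lambda>x. f x + g x) h = L2_inner f h + L2_inner g h"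
  using assms by (simp add: L2_inner_def distrib_right L2_inner_integrable)

lemma L2_inner_cmult_left: "L2_inner (\<lambda>x. c * f x) h = c * L2_inner f h"
  by (simp add: L2_inner_def mult.assoc)

lemma L2_inner_commute: "L2_inner f g = cnj (L2_inner g f)"
  unfolding L2_inner_def by (subst Bochner_Integration.integral_cnj[symmetric]) (simp add: mult.commute)

lemma L2_inner_cong:
  assumes "f \<in> L2" "f' \<in> L2" "g \<in> L2" "g' \<in> L2" "ae_eq f f'" "ae_eq g g'"
  shows "L2_inner f g = L2_inner f' g'"
proof -
  have [measurable]: "f \<in> borel_measurable lborel" "g \<in> borel_measurable lborel"
      "f' \<in> borel_measurable lborel" "g' \<in> borel_measurable lborel"
    using assms by (auto simp: L2_iff)
  have "AE x in lborel. f x * cnj (g x) = f' x * cnj (g' x)"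
    using assms(5,6) unfolding ae_eq_def by eventually_elim simp
  then show ?thesis unfolding L2_inner_def by (intro integral_cong_AE) auto
qed

section \<open>Linear and positivity preserving operators on the space of square-integrable functions\<close>

lemma ae_eq_refl [simp]: "ae_eq f f"
  by (simp add: ae_eq_def)

lemma ae_eq_trans [trans]:
  assumes "ae_eq f g" "ae_eq g h"
  shows "ae_eq f h"
  using assms unfolding ae_eq_def by eventually_elim simp

lemma L2_norm_ae_cong: "f \<in> L2 \<Longrightarrow> g \<in> L2 \<Longrightarrow> ae_eq f g \<Longrightarrow> L2_norm f = L2_norm g"
  by (intro L2_norm_cong_AE) (simp_all add: L2_iff ae_eq_def)

lemma L2_operator:
  assumes "linear_operator L2 S"
  shows L2_operator_in: "f \<in> L2 \<Longrightarrow> S f \<in> L2"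
    and L2_operator_cong: "f \<in> L2 \<Longrightarrow> g \<in> L2 \<Longrightarrow> ae_eq f g \<Longrightarrow> ae_eq (S f) (S g)"
    and L2_operator_add:
      "f \<in> L2 \<Longrightarrow> g \<in> L2 \<Longrightarrow> ae_eq (S (\<lambda>x. f x + g x)) (\<lambda>x. S f x + S g x)"
    and L2_operator_cmult: "f \<in> L2 \<Longrightarrow> ae_eq (S (\<lambda>x. c * f x)) (\<lambda>x. c * S f x)"
  using assms unfolding linear_operator_def by blast+

lemma L2_operator_zero:
  assumes "linear_operator L2 S"
  shows "ae_eq (S (\<lambda>x. 0)) (\<lambda>x. 0)"
  using L2_operator_cmult[OF assms L2_zero(1), of 0] by simp

lemma L2_operator_diff:
  assumes S: "linear_operator L2 S" and f: "f \<in> L2" and g: "g \<in> L2"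
  shows "ae_eq (S (\<lambda>x. f x - g x)) (\<lambda>x. S f x - S g x)"
proof -
  have "ae_eq (S (\<lambda>x. f x + (-1) * g x)) (\<lambda>x. S f x + S (\<lambda>x. (-1) * g x) x)"
    by (rule L2_operator_add[OF S f L2_cmult[OF g]])
  with L2_operator_cmult[OF S g, of "-1"] have
    "ae_eq (S (\<lambda>x. f x + (-1) * g x)) (\<lambda>x. S f x - S g x)"
    unfolding ae_eq_def by eventually_elim simp
  then show ?thesis by simp
qed

lemma bounded_from_toE:
  assumes "bounded_from_to V nV W nW S"
  obtains C where "\<And>f. f \<in> V \<Longrightarrow> S f \<in> W" "\<And>f. f \<in> V \<Longrightarrow> nW (S f) \<le> C * nV f"
proof -
  obtain C where "\<forall>f\<in>V. S f \<in> W \<and> nW (S f) \<le> C * nV f"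
    using assms unfolding bounded_from_to_def by (rule exE)
  then show thesis by (intro that[of C]) simp_all
qed

lemma L2_operator_continuous:
  assumes S: "linear_operator L2 S" and bdd: "bounded_from_to L2 L2_norm L2 L2_norm S"
    and F: "\<And>n. F n \<in> L2" and G: "G \<in> L2"
    and lim: "(\<lambda>n. L2_norm (\<lambda>x. F n x - G x)) \<longlonglongrightarrow> 0"
  shows "(\<lambda>n. L2_norm (\<lambda>x. S (F n) x - S G x)) \<longlonglongrightarrow> 0"
proof -
  obtain C where C: "\<And>f. f \<in> L2 \<Longrightarrow> L2_norm (S f) \<le> C * L2_norm f"
    by (rule bounded_from_toE[OF bdd]) (rule that)
  have "L2_norm (\<lambda>x. S (F n) x - S G x) = L2_norm (S (\<lambda>x. F n x - G x))" for n
    by (rule L2_norm_ae_cong[OF _ _ L2_operator_diff[OF S F G], symmetric];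
        intro L2_diff L2_operator_in[OF S] F G)
  then have le: "L2_norm (\<lambda>x. S (F n) x - S G x) \<le> C * L2_norm (\<lambda>x. F n x - G x)" for n
    using C[OF L2_diff[OF F G]] by simp
  have "(\<lambda>n. C * L2_norm (\<lambda>x. F n x - G x)) \<longlonglongrightarrow> 0"
    using tendsto_mult_left[OF lim, of C] by simp
  then show ?thesis
    by (rule tendsto_sandwich[rotated 2, OF tendsto_const]) (simp_all add: le)
qed

text \<open>The four nonnegative parts of a complex function, as in the definition of \<open>Linf_ext\<close>.\<close>

abbreviation re_pos :: "'d::finite cfun \<Rightarrow> 'd cfun"
  where "re_pos f \<equiv> \<lambda>y. complex_of_real (max 0 (Re (f y)))"
abbreviation re_neg :: "'d::finite cfun \<Rightarrow> 'd cfun"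
  where "re_neg f \<equiv> \<lambda>y. complex_of_real (max 0 (- Re (f y)))"
abbreviation im_pos :: "'d::finite cfun \<Rightarrow> 'd cfun"
  where "im_pos f \<equiv> \<lambda>y. complex_of_real (max 0 (Im (f y)))"
abbreviation im_neg :: "'d::finite cfun \<Rightarrow> 'd cfun"
  where "im_neg f \<equiv> \<lambda>y. complex_of_real (max 0 (- Im (f y)))"

lemma cmod_parts_le:
  "cmod (complex_of_real (max 0 (Re z))) \<le> cmod z"
  "cmod (complex_of_real (max 0 (- Re z))) \<le> cmod z"
  "cmod (complex_of_real (max 0 (Im z))) \<le> cmod z"
  "cmod (complex_of_real (max 0 (- Im z))) \<le> cmod z"
  using abs_Re_le_cmod[of z] abs_Im_le_cmod[of z] by (auto simp: max_def)

lemma L2_parts: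
  assumes f: "f \<in> L2"
  shows "re_pos f \<in> L2" "re_neg f \<in> L2" "im_pos f \<in> L2" "im_neg f \<in> L2"
    and "L2_norm (re_pos f) \<le> L2_norm f" "L2_norm (re_neg f) \<le> L2_norm f"
      "L2_norm (im_pos f) \<le> L2_norm f" "L2_norm (im_neg f) \<le> L2_norm f"
proof -
  have [measurable]: "f \<in> borel_measurable lborel" using f by (simp add: L2_iff)
  show "re_pos f \<in> L2" "L2_norm (re_pos f) \<le> L2_norm f"
    by (rule L2_dominated[OF f _ AE_I2], measurable, rule cmod_parts_le)+
  show "re_neg f \<in> L2" "L2_norm (re_neg f) \<le> L2_norm f"
    by (rule L2_dominated[OF f _ AE_I2], measurable, rule cmod_parts_le)+
  show "im_pos f \<in> L2" "L2_norm (im_pos f) \<le> L2_norm f"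
    by (rule L2_dominated[OF f _ AE_I2], measurable, rule cmod_parts_le)+
  show "im_neg f \<in> L2" "L2_norm (im_neg f) \<le> L2_norm f"
    by (rule L2_dominated[OF f _ AE_I2], measurable, rule cmod_parts_le)+
qed

text \<open>The values of \<open>S\<close> on the four nonnegative parts, where positivity applies, determine it.\<close>

lemma L2_operator_parts:
  assumes S: "linear_operator L2 S" and f: "f \<in> L2"
  shows "AE x in lborel. S f x = S (re_pos f) x - S (re_neg f) x + \<i> * S (im_pos f) x - \<i> * S (im_neg f) x"
proof -
  note P = L2_parts[OF f]
  define u where "u = (\<lambda>x. re_pos f x - re_neg f x)"
  define v where "v = (\<lambda>x. im_pos f x - im_neg f x)"
  have uv: "u \<in> L2" "v \<in> L2" unfolding u_def v_def using P by (auto intro!: L2_diff)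
  have "f = (\<lambda>x. u x + \<i> * v x)"
    by (auto simp: u_def v_def fun_eq_iff complex_eq_iff max_def)
  then have "ae_eq (S f) (S (\<lambda>x. u x + \<i> * v x))" by simp
  also have "ae_eq (S (\<lambda>x. u x + \<i> * v x)) (\<lambda>x. S u x + S (\<lambda>x. \<i> * v x) x)"
    by (rule L2_operator_add[OF S uv(1) L2_cmult[OF uv(2)]])
  finally have "ae_eq (S f) (\<lambda>x. S u x + S (\<lambda>x. \<i> * v x) x)" .
  moreover have "ae_eq (S (\<lambda>x. \<i> * v x)) (\<lambda>x. \<i> * S v x)"
    by (rule L2_operator_cmult[OF S uv(2)])
  moreover have "ae_eq (S u) (\<lambda>x. S (re_pos f) x - S (re_neg f) x)"
    unfolding u_def by (rule L2_operator_diff[OF S P(1,2)])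
  moreover have "ae_eq (S v) (\<lambda>x. S (im_pos f) x - S (im_neg f) x)"
    unfolding v_def by (rule L2_operator_diff[OF S P(3,4)])
  ultimately show ?thesis
    unfolding ae_eq_def by eventually_elim (simp add: algebra_simps)
qed

lemma positivity_improving_preserves:
  assumes S: "linear_operator L2 S" and pos: "positivity_improving S"
    and f: "f \<in> L2" "AE x in lborel. f x \<in> \<real>\<^sub>\<ge>\<^sub>0"
  shows "AE x in lborel. S f x \<in> \<real>\<^sub>\<ge>\<^sub>0"
proof (cases "ae_eq f (\<lambda>x. 0)")
  case True
  have "ae_eq (S f) (\<lambda>x. 0)"
    using L2_operator_cong[OF S f(1) L2_zero(1) True] L2_operator_zero[OF S] by (rule ae_eq_trans)
  then show ?thesis unfolding ae_eq_def by eventually_elim simp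
next
  case False
  with pos f have "AE x in lborel. S f x \<in> \<real>\<^sub>\<ge>\<^sub>0 - {0}"
    unfolding positivity_improving_def by blast
  then show ?thesis by eventually_elim simp
qed

lemma positive_operator_mono:
  assumes S: "linear_operator L2 S" and pos: "positivity_improving S"
    and f: "f \<in> L2" "AE x in lborel. f x \<in> \<real>\<^sub>\<ge>\<^sub>0"
    and g: "g \<in> L2" "AE x in lborel. g x - f x \<in> \<real>\<^sub>\<ge>\<^sub>0"
  shows "AE x in lborel. cmod (S f x) \<le> cmod (S g x)"
proof -
  have "AE x in lborel. S (\<lambda>x. g x - f x) x \<in> \<real>\<^sub>\<ge>\<^sub>0"
    by (rule positivity_improving_preserves[OF S pos L2_diff[OF g(1) f(1)] g(2)])
  with L2_operator_diff[OF S g(1) f(1)] positivity_improving_preserves[OF S pos f]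
  show ?thesis unfolding ae_eq_def
  proof eventually_elim
    case (elim x)
    then obtain a b where "0 \<le> a" "S f x = complex_of_real a" "0 \<le> b" "S g x - S f x = complex_of_real b"
      by (metis nonneg_Reals_cases)
    then have "S g x = complex_of_real (a + b)" by (simp add: algebra_simps)
    with \<open>S f x = _\<close> \<open>0 \<le> a\<close> \<open>0 \<le> b\<close> show ?case by (simp del: of_real_add)
  qed
qed

section \<open>Local boundedness of the semigroup\<close>

lemma C0_semigroupD:
  assumes "C0_semigroup T"
  shows C0_semigroup_operator: "0 \<le> t \<Longrightarrow> linear_operator L2 (T t)"
    and C0_semigroup_bounded: "0 \<le> t \<Longrightarrow> bounded_from_to L2 L2_norm L2 L2_norm (T t)"
    and C0_semigroup_0: "f \<in> L2 \<Longrightarrow> ae_eq (T 0 f) f"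
    and C0_semigroup_add: "0 \<le> s \<Longrightarrow> 0 \<le> t \<Longrightarrow> f \<in> L2 \<Longrightarrow> ae_eq (T (s + t) f) (T s (T t f))"
    and C0_semigroup_right_cont:
      "f \<in> L2 \<Longrightarrow> ((\<lambda>t. L2_norm (\<lambda>x. T t f x - f x)) \<longlongrightarrow> 0) (at_right 0)"
  using assms unfolding C0_semigroup_def by blast+

text \<open>A majorant of all \<open>2\<^sup>-\<^sup>n \<bar>f n\<bar>\<close> at once.  Their sum would do as well; the square root of the sum of
  their squares has the advantage that its norm is computed by monotone convergence alone.\<close>

lemma L2_weighted_majorant:
  fixes f :: "nat \<Rightarrow> 'a \<Rightarrow> complex"
  assumes f: "\<And>n. f n \<in> Lp_space M 2" "\<And>n. Lp_norm M 2 (f n) = 1"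
  shows "\<exists>F\<in>Lp_space M 2. (AE x in M. F x \<in> \<real>\<^sub>\<ge>\<^sub>0) \<and> (\<forall>n. AE x in M. (1/2)^n * cmod (f n x) \<le> cmod (F x))"
proof -
  have [measurable]: "\<And>n. f n \<in> borel_measurable M" using f by (simp add: L2_iff)
  define G where "G x = (\<Sum>n. ennreal ((1/4)^n * (cmod (f n x))\<^sup>2))" for x
  have [measurable]: "G \<in> borel_measurable M" unfolding G_def by measurable
  have "(\<integral>\<^sup>+x. G x \<partial>M) = (\<Sum>n. \<integral>\<^sup>+x. ennreal ((1/4)^n * (cmod (f n x))\<^sup>2) \<partial>M)"
    unfolding G_def by (rule nn_integral_suminf) measurable
  also have "\<dots> = (\<Sum>n. ennreal ((1/4)^n))"
  proof (rule arg_cong[where f=suminf], rule ext)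
    fix n
    have "(\<integral>\<^sup>+x. ennreal ((1/4)^n * (cmod (f n x))\<^sup>2) \<partial>M)
        = ennreal ((1/4)^n) * (\<integral>\<^sup>+x. ennreal ((cmod (f n x))\<^sup>2) \<partial>M)"
      by (subst nn_integral_cmult[symmetric]) (simp_all add: ennreal_mult)
    then show "(\<integral>\<^sup>+x. ennreal ((1/4)^n * (cmod (f n x))\<^sup>2) \<partial>M) = ennreal ((1/4)^n)"
      by (simp add: nn_integral_L2_norm[OF f(1)] f(2))
  qed
  also have "\<dots> = ennreal (\<Sum>n. (1/4)^n)"
    by (rule suminf_ennreal2) (auto intro: summable_geometric)
  finally have fin: "(\<integral>\<^sup>+x. G x \<partial>M) < \<infinity>" by simp
  then have G_fin: "AE x in M. G x \<noteq> \<infinity>"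
    by (intro nn_integral_PInf_AE) auto
  \<comment> \<open>Where the series diverges \<open>F\<close> is 0, but that happens only on a null set.\<close>
  define F where "F x = complex_of_real (sqrt (enn2real (G x)))" for x
  have F_sq: "(cmod (F x))\<^sup>2 = enn2real (G x)" for x by (simp add: F_def)
  have [measurable]: "F \<in> borel_measurable M" unfolding F_def by measurable
  have "integrable M (\<lambda>x. enn2real (G x))"
  proof (rule integrableI_nonneg)
    have "(\<integral>\<^sup>+x. ennreal (enn2real (G x)) \<partial>M) \<le> (\<integral>\<^sup>+x. G x \<partial>M)"
      by (intro nn_integral_mono) (simp add: ennreal_enn2real_if)
    then show "(\<integral>\<^sup>+x. ennreal (enn2real (G x)) \<partial>M) < \<infinity>" using fin by simp
  qed auto
  then have "F \<in> Lp_space M 2" by (simp add: L2_iff F_sq)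
  moreover have "AE x in M. (1/2)^n * cmod (f n x) \<le> cmod (F x)" for n
    using G_fin
  proof eventually_elim
    case (elim x)
    have "ennreal ((1/4)^n * (cmod (f n x))\<^sup>2) \<le> G x"
      unfolding G_def
      by (rule sum_le_suminf[OF summableI, of "{n}", simplified])
    also have "G x = ennreal (enn2real (G x))"
      using elim by (simp add: less_top)
    finally have "(1/4)^n * (cmod (f n x))\<^sup>2 \<le> enn2real (G x)"
      by (subst (asm) ennreal_le_iff) simp_all
    also have "enn2real (G x) = (cmod (F x))\<^sup>2" by (simp add: F_sq)
    also have "(1/4)^n * (cmod (f n x))\<^sup>2 = ((1/2)^n * cmod (f n x))\<^sup>2"
      by (simp add: power2_eq_square flip: power_mult_distrib)
    finally show ?case by (rule power2_le_imp_le) simp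
  qed
  moreover have "AE x in M. F x \<in> \<real>\<^sub>\<ge>\<^sub>0" by (simp add: F_def)
  ultimately show ?thesis by blast
qed

text \<open>A uniform boundedness principle in which positivity replaces the gliding hump.  If the norms of \<open>T (s n)\<close>
  exceeded \<open>4\<^sup>n\<close> along times \<open>s n\<close> tending to 0, as seen on unit vectors \<open>f n \<ge> 0\<close>, then a single \<open>F\<close> above all
  \<open>2\<^sup>-\<^sup>n f n\<close> would satisfy \<open>\<parallel>T (s n) F\<parallel> \<ge> 2\<^sup>-\<^sup>n \<parallel>T (s n) (f n)\<parallel> \<ge> 2\<^sup>n\<close>, although \<open>T (s n) F\<close> converges
  to \<open>F\<close>.\<close>

lemma semigroup_bounded_near_0_nonneg:
  assumes T: "C0_semigroup T" and b: "assumption_b T"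
  shows "\<exists>\<delta>>0. \<exists>K\<ge>0. \<forall>s f. 0 < s \<longrightarrow> s \<le> \<delta> \<longrightarrow> f \<in> L2 \<longrightarrow> (AE x in lborel. f x \<in> \<real>\<^sub>\<ge>\<^sub>0)
     \<longrightarrow> L2_norm (T s f) \<le> K * L2_norm f"
proof (rule ccontr)
  assume neg: "\<not> ?thesis"
  have "\<exists>s f. 0 < s \<and> s \<le> 1 / Suc n \<and> f \<in> L2 \<and> (AE x in lborel. f x \<in> \<real>\<^sub>\<ge>\<^sub>0) \<and> 4^n * L2_norm f < L2_norm (T s f)" for n
  proof (rule ccontr)
    assume "\<not> ?thesis"
    then have "\<forall>s f. 0 < s \<longrightarrow> s \<le> 1 / Suc n \<longrightarrow> f \<in> L2 \<longrightarrow> (AE x in lborel. f x \<in> \<real>\<^sub>\<ge>\<^sub>0)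
       \<longrightarrow> L2_norm (T s f) \<le> 4^n * L2_norm f"
      by (metis not_less)
    moreover have "(0::real) < 1 / Suc n" "(0::real) \<le> 4^n" by simp_all
    ultimately show False using neg by blast
  qed
  then obtain s f where s: "\<And>n. 0 < s n" "\<And>n. s n \<le> 1 / Suc n"
    and f: "\<And>n. f n \<in> L2" "\<And>n. AE x in lborel. f n x \<in> \<real>\<^sub>\<ge>\<^sub>0"
    and big: "\<And>n. 4^n * L2_norm (f n) < L2_norm (T (s n) (f n))"
    by metis
  have S: "linear_operator L2 (T (s n))" "positivity_improving (T (s n))" for n
    using C0_semigroup_operator[OF T, of "s n"] b s(1)[of n] by (auto simp: assumption_b_def)
  have pos: "0 < L2_norm (f n)" for n
  proof (rule ccontr)
    assume "\<not> 0 < L2_norm (f n)"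
    then have 0: "L2_norm (f n) = 0" using L2_norm_nonneg[of lborel "f n"] by linarith
    obtain C where "\<And>g. g \<in> L2 \<Longrightarrow> L2_norm (T (s n) g) \<le> C * L2_norm g"
      by (rule bounded_from_toE[OF C0_semigroup_bounded[OF T less_imp_le[OF s(1)[of n]]]]) (rule that)
    from this[OF f(1)[of n]] big[of n] 0 show False by simp
  qed
  define c where "c n = complex_of_real (1 / L2_norm (f n))" for n
  define g where "g n = (\<lambda>x. c n * f n x)" for n
  have g: "g n \<in> L2" "L2_norm (g n) = 1" for n
  proof -
    show "g n \<in> L2" unfolding g_def by (rule L2_cmult[OF f(1)])
    show "L2_norm (g n) = 1"
      using pos[of n] unfolding g_def L2_norm_cmult c_def norm_of_real by simp
  qed
  obtain F where F: "F \<in> L2" "AE x in lborel. F x \<in> \<real>\<^sub>\<ge>\<^sub>0"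
      "\<And>n. AE x in lborel. (1/2)^n * cmod (g n x) \<le> cmod (F x)"
    using L2_weighted_majorant[of g lborel, OF g] by blast
  have ge: "2^n \<le> L2_norm (T (s n) F)" for n
  proof -
    define d where "d = complex_of_real ((1/2)^n / L2_norm (f n))"
    have d: "d = (1/2)^n * c n" by (simp add: d_def c_def)
    define h where "h = (\<lambda>x. d * f n x)"
    have h: "h \<in> L2" unfolding h_def by (rule L2_cmult[OF f(1)])
    have h_nonneg: "AE x in lborel. h x \<in> \<real>\<^sub>\<ge>\<^sub>0"
      using f(2)[of n]
      by eventually_elim (use pos[of n] in \<open>auto simp: h_def d_def intro!: nonneg_Reals_mult_I\<close>)
    have F_h: "AE x in lborel. F x - h x \<in> \<real>\<^sub>\<ge>\<^sub>0"
      using h_nonneg F(2) F(3)[of n]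
    proof eventually_elim
      case (elim x)
      obtain a where a: "h x = complex_of_real a" "0 \<le> a" using elim(1) by (metis nonneg_Reals_cases)
      obtain b where b: "F x = complex_of_real b" "0 \<le> b" using elim(2) by (metis nonneg_Reals_cases)
      have "cmod (h x) = (1/2)^n * cmod (g n x)"
        by (simp add: h_def g_def d norm_mult norm_power norm_divide)
      with elim(3) a b have "a \<le> b" by simp
      then show ?case by (simp add: a b flip: of_real_diff)
    qed
    have "2^n = (1/2)^n * (4::real)^n" by (simp flip: power_mult_distrib)
    also have "\<dots> \<le> (1/2)^n * (L2_norm (T (s n) (f n)) / L2_norm (f n))"
      using big[of n] pos[of n] by (intro mult_left_mono) (simp_all add: field_simps)
    also have "\<dots> = L2_norm (\<lambda>x. d * T (s n) (f n) x)"
      using pos[of n] unfolding L2_norm_cmult d_def norm_of_real by simp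
    also have "\<dots> = L2_norm (T (s n) h)"
      unfolding h_def
      by (rule L2_norm_ae_cong[OF _ _ L2_operator_cmult[OF S(1) f(1)], symmetric];
          intro L2_operator_in[OF S(1)] L2_cmult f(1))
    also have "\<dots> \<le> L2_norm (T (s n) F)"
    proof (rule L2_dominated)
      show "T (s n) F \<in> L2" by (rule L2_operator_in[OF S(1) F(1)])
      show "T (s n) h \<in> borel_measurable lborel"
        using L2_operator_in[OF S(1) h] by (simp add: L2_iff)
      show "AE x in lborel. cmod (T (s n) h x) \<le> cmod (T (s n) F x)"
        by (rule positive_operator_mono[OF S h h_nonneg F(1) F_h])
    qed
    finally show ?thesis .
  qed
  have "s \<longlonglongrightarrow> 0"
    by (rule tendsto_sandwich[OF _ _ tendsto_const LIMSEQ_inverse_real_of_nat])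
      (use s in \<open>simp_all add: less_imp_le inverse_eq_divide\<close>)
  then have "filterlim s (at_right 0) sequentially"
    by (intro tendsto_imp_filterlim_at_right) (simp_all add: s)
  then have "(\<lambda>n. L2_norm (\<lambda>x. T (s n) F x - F x)) \<longlonglongrightarrow> 0"
    by (rule filterlim_compose[OF C0_semigroup_right_cont[OF T F(1)]])
  then have ev1: "\<forall>\<^sub>F n in sequentially. L2_norm (\<lambda>x. T (s n) F x - F x) < 1"
    by (rule order_tendstoD) simp
  obtain N where N: "L2_norm F + 1 < 2^N"
    using real_arch_pow[of 2 "L2_norm F + 1"] by auto
  have ev2: "\<forall>\<^sub>F n in sequentially. L2_norm F + 1 < 2^n"
    using eventually_ge_at_top[of N]
  proof eventually_elim
    case (elim n)
    have "(2::real)^N \<le> 2^n" using elim by (intro power_increasing) simp_all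
    with N show ?case by (rule less_le_trans)
  qed
  have "\<forall>\<^sub>F n in sequentially. False"
    using ev1 ev2
  proof eventually_elim
    case (elim n)
    have "L2_norm (T (s n) F) = L2_norm (\<lambda>x. (T (s n) F x - F x) + F x)" by simp
    also have "\<dots> \<le> L2_norm (\<lambda>x. T (s n) F x - F x) + L2_norm F"
      by (intro L2_triangle L2_diff L2_operator_in[OF S(1)] F(1))
    finally show ?case using elim ge[of n] by simp
  qed
  then show False by simp
qed

lemma semigroup_bounded_near_0:
  assumes T: "C0_semigroup T" and b: "assumption_b T"
  shows "\<exists>\<delta>>0. \<exists>K\<ge>1. \<forall>s f. 0 \<le> s \<longrightarrow> s \<le> \<delta> \<longrightarrow> f \<in> L2 \<longrightarrow> L2_norm (T s f) \<le> K * L2_norm f"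
proof -
  obtain \<delta> K where \<delta>: "\<delta> > 0" and K: "K \<ge> 0"
    and bound: "\<And>s f. 0 < s \<Longrightarrow> s \<le> \<delta> \<Longrightarrow> f \<in> L2 \<Longrightarrow> (AE x in lborel. f x \<in> \<real>\<^sub>\<ge>\<^sub>0)
       \<Longrightarrow> L2_norm (T s f) \<le> K * L2_norm f"
    using semigroup_bounded_near_0_nonneg[OF T b] by metis
  have "L2_norm (T s f) \<le> max 1 (4 * K) * L2_norm f" if s: "0 \<le> s" "s \<le> \<delta>" and f: "f \<in> L2" for s f
  proof (cases "s = 0")
    case True
    have "L2_norm (T 0 f) = L2_norm f"
        by (rule L2_norm_ae_cong[OF _ f C0_semigroup_0[OF T f]])
        (rule L2_operator_in[OF C0_semigroup_operator[OF T] f], simp)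
    then show ?thesis using True by (simp add: mult_right_mono[of 1 "max 1 (4 * K)" "L2_norm f", simplified])
  next
    case False
    then have s: "0 < s" "s \<le> \<delta>" using s by auto
    have S: "linear_operator L2 (T s)" using C0_semigroup_operator[OF T] s by simp
    note P = L2_parts[OF f]
    have in_L2: "T s (re_pos f) \<in> L2" "T s (re_neg f) \<in> L2" "T s (im_pos f) \<in> L2" "T s (im_neg f) \<in> L2"
      using P L2_operator_in[OF S] by blast+
    have part: "L2_norm (T s g) \<le> K * L2_norm f"
      if "g \<in> L2" "\<And>x. g x \<in> \<real>\<^sub>\<ge>\<^sub>0" "L2_norm g \<le> L2_norm f" for g
      using bound[OF s that(1)] that(2) mult_left_mono[OF that(3) K] by (auto intro: order_trans)
    have parts: "L2_norm (T s (re_pos f)) \<le> K * L2_norm f" "L2_norm (T s (re_neg f)) \<le> K * L2_norm f"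
       "L2_norm (T s (im_pos f)) \<le> K * L2_norm f" "L2_norm (T s (im_neg f)) \<le> K * L2_norm f"
      by (intro part P; simp)+
    have "L2_norm (T s f)
      = L2_norm (\<lambda>x. T s (re_pos f) x + (-1) * T s (re_neg f) x + \<i> * T s (im_pos f) x + (-\<i>) * T s (im_neg f) x)"
      using L2_operator_parts[OF S f]
      by (intro L2_norm_ae_cong L2_add L2_cmult in_L2 L2_operator_in[OF S f]) (simp_all add: ae_eq_def)
    also have "\<dots> \<le> L2_norm (\<lambda>x. T s (re_pos f) x + (-1) * T s (re_neg f) x + \<i> * T s (im_pos f) x)
        + L2_norm (\<lambda>x. (-\<i>) * T s (im_neg f) x)"
      by (intro L2_triangle L2_add L2_cmult in_L2)
    also have "\<dots> \<le> L2_norm (\<lambda>x. T s (re_pos f) x + (-1) * T s (re_neg f) x) + L2_norm (\<lambda>x. \<i> * T s (im_pos f) x)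
        + L2_norm (\<lambda>x. (-\<i>) * T s (im_neg f) x)"
      by (intro add_right_mono L2_triangle L2_add L2_cmult in_L2)
    also have "\<dots> \<le> L2_norm (T s (re_pos f)) + L2_norm (\<lambda>x. (-1) * T s (re_neg f) x) + L2_norm (\<lambda>x. \<i> * T s (im_pos f) x)
        + L2_norm (\<lambda>x. (-\<i>) * T s (im_neg f) x)"
      by (intro add_right_mono L2_triangle L2_add L2_cmult in_L2)
    also have "\<dots> \<le> 4 * K * L2_norm f"
      using parts unfolding L2_norm_cmult by simp
    also have "\<dots> \<le> max 1 (4 * K) * L2_norm f"
      by (intro mult_right_mono) simp_all
    finally show ?thesis .
  qed
  then show ?thesis using \<delta> by (intro exI[of _ \<delta>] exI[of _ "max 1 (4 * K)"] conjI) simp_all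
qed

lemma semigroup_locally_bounded:
  assumes T: "C0_semigroup T" and b: "assumption_b T"
  shows "\<exists>K\<ge>0. \<forall>s f. 0 \<le> s \<longrightarrow> s \<le> t \<longrightarrow> f \<in> L2 \<longrightarrow> L2_norm (T s f) \<le> K * L2_norm f"
proof -
  obtain \<delta> K where \<delta>: "\<delta> > 0" and K: "K \<ge> 1"
    and bound: "\<And>s f. 0 \<le> s \<Longrightarrow> s \<le> \<delta> \<Longrightarrow> f \<in> L2 \<Longrightarrow> L2_norm (T s f) \<le> K * L2_norm f"
    using semigroup_bounded_near_0[OF T b] by metis
  have iter: "L2_norm (T s f) \<le> K ^ n * L2_norm f" if "0 \<le> s" "s \<le> n * \<delta>" "f \<in> L2" for n s f
    using that
  proof (induction n arbitrary: s f)
    case 0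
    then show ?case using bound[of 0 f]
      using L2_norm_ae_cong[OF L2_operator_in[OF C0_semigroup_operator[OF T]] _ C0_semigroup_0[OF T], of f]
      by simp
  next
    case (Suc n)
    show ?case
    proof (cases "s \<le> \<delta>")
      case True
      have "L2_norm (T s f) \<le> K * L2_norm f" using bound Suc.prems True by blast
      also have "\<dots> \<le> K ^ Suc n * L2_norm f"
        using K self_le_power[of K "Suc n"] by (intro mult_right_mono) simp_all
      finally show ?thesis .
    next
      case False
      let ?r = "s - \<delta>"
      have r: "0 \<le> ?r" "?r \<le> n * \<delta>" using False Suc.prems by (simp_all add: algebra_simps)
      have in_L2: "T ?r f \<in> L2" using C0_semigroup_operator[OF T r(1)] Suc.prems(3) by (rule L2_operator_in)
      have "L2_norm (T s f) = L2_norm (T \<delta> (T ?r f))"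
        using C0_semigroup_add[OF T _ r(1) Suc.prems(3), of \<delta>] \<delta> Suc.prems in_L2 False
        by (intro L2_norm_ae_cong L2_operator_in[OF C0_semigroup_operator[OF T]]) simp_all
      also have "\<dots> \<le> K * L2_norm (T ?r f)" using bound[OF _ _ in_L2] \<delta> by simp
      also have "\<dots> \<le> K * (K ^ n * L2_norm f)"
        using K Suc.IH[OF r Suc.prems(3)] by (intro mult_left_mono) simp_all
      finally show ?thesis by simp
    qed
  qed
  obtain n :: nat where "t / \<delta> \<le> n" using real_arch_simple by blast
  then have "t \<le> n * \<delta>" using \<delta> by (simp add: field_simps)
  then have "\<forall>s f. 0 \<le> s \<longrightarrow> s \<le> t \<longrightarrow> f \<in> L2 \<longrightarrow> L2_norm (T s f) \<le> K ^ n * L2_norm f"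
    using iter[of _ n] by (meson order_trans)
  then show ?thesis using K by (intro exI[of _ "K ^ n"]) simp
qed

section \<open>Symmetry of the semigroup\<close>

lemma L2_inner_add_right:
  assumes "f \<in> L2" "g \<in> L2" "h \<in> L2"
  shows "L2_inner h (\<lambda>x. f x + g x) = L2_inner h f + L2_inner h g"
  using arg_cong[OF L2_inner_add_left[OF assms], of cnj] by (simp add: L2_inner_commute[of h])

lemma L2_inner_diff_right:
  assumes "f \<in> L2" "g \<in> L2" "h \<in> L2"
  shows "L2_inner h (\<lambda>x. f x - g x) = L2_inner h f - L2_inner h g"
  using arg_cong[OF L2_inner_diff_left[OF assms], of cnj] by (simp add: L2_inner_commute[of h])

lemma L2_inner_cmult_right: "L2_inner h (\<lambda>x. c * f x) = cnj c * L2_inner h f"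
  using arg_cong[OF L2_inner_cmult_left[of c f h], of cnj] by (simp add: L2_inner_commute[of h])

lemma L2_inner_tendsto:
  assumes F: "\<And>n. F n \<in> L2" "f \<in> L2" "(\<lambda>n. L2_norm (\<lambda>x. F n x - f x)) \<longlonglongrightarrow> 0"
    and G: "\<And>n. G n \<in> L2" "g \<in> L2" "(\<lambda>n. L2_norm (\<lambda>x. G n x - g x)) \<longlonglongrightarrow> 0"
  shows "(\<lambda>n. L2_inner (F n) (G n)) \<longlonglongrightarrow> L2_inner f g"
proof (rule LIM_zero_cancel, rule Lim_null_comparison)
  let ?dF = "\<lambda>n x. F n x - f x" and ?dG = "\<lambda>n x. G n x - g x"
  let ?b = "\<lambda>n. L2_norm (?dF n) * (L2_norm (?dG n) + L2_norm g) + L2_norm f * L2_norm (?dG n)"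
  have "norm (L2_inner (F n) (G n) - L2_inner f g) \<le> ?b n" for n
  proof -
    have d: "?dF n \<in> L2" "?dG n \<in> L2" by (intro L2_diff F G)+
    have "L2_inner (F n) (G n) - L2_inner f g = L2_inner (?dF n) (G n) + L2_inner f (?dG n)"
      using F G by (simp add: L2_inner_diff_left L2_inner_diff_right)
    then have "norm (L2_inner (F n) (G n) - L2_inner f g)
        \<le> norm (L2_inner (?dF n) (G n)) + norm (L2_inner f (?dG n))"
      by (simp only: norm_triangle_ineq)
    also have "norm (L2_inner (?dF n) (G n)) \<le> L2_norm (?dF n) * L2_norm (G n)"
      by (rule L2_inner_bound[OF d(1) G(1)])
    also have "L2_norm (G n) \<le> L2_norm (?dG n) + L2_norm g"
      using L2_triangle[OF d(2) G(2)] by simp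
    also have "norm (L2_inner f (?dG n)) \<le> L2_norm f * L2_norm (?dG n)"
      by (rule L2_inner_bound[OF F(2) d(2)])
    finally show ?thesis by (simp add: mult_left_mono)
  qed
  then show "\<forall>\<^sub>F n in sequentially. norm (L2_inner (F n) (G n) - L2_inner f g) \<le> ?b n" by simp
  have "?b \<longlonglongrightarrow> 0 * (0 + L2_norm g) + L2_norm f * 0"
    by (intro tendsto_intros F(3) G(3))
  then show "?b \<longlonglongrightarrow> 0" by simp
qed

text \<open>The error of the first order expansion \<open>T h f = f - h H f + o(h)\<close>, divided by \<open>h\<close>.\<close>

definition generator_error ::
  "(real \<Rightarrow> 'd::finite cfun \<Rightarrow> 'd cfun) \<Rightarrow> ('d cfun \<Rightarrow> 'd cfun) \<Rightarrow> real \<Rightarrow> 'd cfun \<Rightarrow> 'd cfun" where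
  "generator_error T H h f = (\<lambda>x. (T h f x - f x) / complex_of_real h + H f x)"

lemma linear_operatorD:
  assumes "linear_operator D H" "f \<in> D"
  shows "f \<in> L2" "H f \<in> L2"
  using assms unfolding linear_operator_def by blast+

lemma self_adjoint_symmetric:
  assumes sa: "self_adjoint D H" and f: "f \<in> D" and g: "g \<in> D"
  shows "L2_inner (H f) g = L2_inner f (H g)"
proof -
  have "H g \<in> L2" using sa linear_operatorD(2)[OF _ g] by (simp add: self_adjoint_def)
  then have "(g, H g) \<in> {(g, h). g \<in> D \<and> h \<in> L2 \<and> ae_eq h (H g)}" using g by simp
  also have "\<dots> = adjoint_graph D H" using sa by (simp add: self_adjoint_def)
  finally show ?thesis using f by (simp add: adjoint_graph_def)
qed

lemma exp_semigroup_C0: "exp_semigroup D H T \<Longrightarrow> C0_semigroup T"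
  by (simp add: exp_semigroup_def)

context
  fixes D :: "'d::finite cfun set" and H :: "'d cfun \<Rightarrow> 'd cfun"
    and T :: "real \<Rightarrow> 'd cfun \<Rightarrow> 'd cfun"
  assumes sa: "self_adjoint D H" and es: "exp_semigroup D H T"
begin

lemma domain_L2: "f \<in> D \<Longrightarrow> f \<in> L2" "f \<in> D \<Longrightarrow> H f \<in> L2"
  using sa linear_operatorD[of D H f] by (simp_all add: self_adjoint_def)

lemmas C0 = exp_semigroup_C0[OF es]

lemma semigroup_in_L2: "0 \<le> t \<Longrightarrow> f \<in> L2 \<Longrightarrow> T t f \<in> L2"
  by (rule L2_operator_in[OF C0_semigroup_operator[OF C0]])

lemma generator_error_L2:
  assumes "0 \<le> h" "f \<in> D"
  shows "generator_error T H h f \<in> L2"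
proof -
  have "(\<lambda>x. (1 / complex_of_real h) * (T h f x - f x)) \<in> L2"
    by (intro L2_cmult L2_diff semigroup_in_L2 domain_L2(1) assms)
  from L2_add[OF this domain_L2(2)[OF assms(2)]] show ?thesis
    by (simp add: generator_error_def)
qed

lemma generator_iff:
  assumes "f \<in> L2" "g \<in> L2"
  shows "((\<lambda>t. L2_norm (\<lambda>x. (T t f x - f x) / complex_of_real t - g x)) \<longlongrightarrow> 0) (at_right 0)
    \<longleftrightarrow> f \<in> D \<and> ae_eq g (\<lambda>x. - H f x)"
  using es assms unfolding exp_semigroup_def by (elim conjE) (drule bspec, assumption, erule bspec, assumption)

lemma generator_error_tendsto:
  assumes f: "f \<in> D"
  shows "((\<lambda>h. L2_norm (generator_error T H h f)) \<longlongrightarrow> 0) (at_right 0)"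
proof -
  have g: "(\<lambda>x. - H f x) \<in> L2"
    using L2_cmult[OF domain_L2(2)[OF f], of "-1"] by simp
  have "((\<lambda>t. L2_norm (\<lambda>x. (T t f x - f x) / complex_of_real t - (- H f x))) \<longlongrightarrow> 0) (at_right 0)"
    by (rule iffD2[OF generator_iff[OF domain_L2(1)[OF f] g]]) (simp add: f)
  then show ?thesis by (simp add: generator_error_def)
qed

lemma generator_error_shift_aux:
  assumes f: "f \<in> D" and s: "0 \<le> s" and h: "0 < h"
  shows "AE x in lborel. (T h (T s f) x - T s f x) / complex_of_real h + T s (H f) x
     = T s (generator_error T H h f) x"
proof -
  note fL = domain_L2[OF f]
  have h0: "0 \<le> h" using h by simp
  note S = C0_semigroup_operator[OF C0 s]
  let ?q = "\<lambda>x. (1 / complex_of_real h) * (T h f x - f x)"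
  have dL: "(\<lambda>x. T h f x - f x) \<in> L2" by (intro L2_diff semigroup_in_L2 h0 fL)
  have qL: "?q \<in> L2" by (rule L2_cmult[OF dL])
  have 1: "ae_eq (T s (\<lambda>x. ?q x + H f x)) (\<lambda>x. T s ?q x + T s (H f) x)"
    by (rule L2_operator_add[OF S qL fL(2)])
  have 2: "ae_eq (T s ?q) (\<lambda>x. (1 / complex_of_real h) * T s (\<lambda>x. T h f x - f x) x)"
    by (rule L2_operator_cmult[OF S dL])
  have 3: "ae_eq (T s (\<lambda>x. T h f x - f x)) (\<lambda>x. T s (T h f) x - T s f x)"
    by (rule L2_operator_diff[OF S semigroup_in_L2[OF h0 fL(1)] fL(1)])
  have "ae_eq (T (s + h) f) (T s (T h f))" "ae_eq (T (h + s) f) (T h (T s f))"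
    by (rule C0_semigroup_add[OF C0 s h0 fL(1)], rule C0_semigroup_add[OF C0 h0 s fL(1)])
  with 1 2 3 show ?thesis
    unfolding ae_eq_def
    by eventually_elim (simp add: generator_error_def add.commute)
qed

text \<open>Since \<open>T s\<close> commutes with \<open>T h\<close>, it maps difference quotients to difference quotients; hence it
  preserves the domain of the generator and commutes with it.\<close>

lemma semigroup_domain:
  assumes f: "f \<in> D" and s: "0 \<le> s"
  shows "T s f \<in> D" "ae_eq (H (T s f)) (T s (H f))"
proof -
  note fL = domain_L2[OF f]
  note S = C0_semigroup_operator[OF C0 s]
  have TsH: "T s (H f) \<in> L2" by (rule semigroup_in_L2[OF s fL(2)])
  have g: "(\<lambda>x. - T s (H f) x) \<in> L2"
    using L2_cmult[OF TsH, of "-1"] by simp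
  obtain C where C: "\<And>g. g \<in> L2 \<Longrightarrow> L2_norm (T s g) \<le> C * L2_norm g"
    by (rule bounded_from_toE[OF C0_semigroup_bounded[OF C0 s]]) (rule that)
  let ?e = "\<lambda>h x. (T h (T s f) x - T s f x) / complex_of_real h - (- T s (H f) x)"
  have le: "L2_norm (?e h) \<le> C * L2_norm (generator_error T H h f)" if h: "0 < h" for h
  proof -
    have h0: "0 \<le> h" using h by simp
    have "(\<lambda>x. (1 / complex_of_real h) * (T h (T s f) x - T s f x)) \<in> L2"
      by (intro L2_cmult L2_diff semigroup_in_L2 s h0 fL)
    from L2_add[OF this TsH] have eL: "?e h \<in> L2" by simp
    have "ae_eq (?e h) (T s (generator_error T H h f))"
      using generator_error_shift_aux[OF f s h] by (simp add: ae_eq_def)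
    then have "L2_norm (?e h) = L2_norm (T s (generator_error T H h f))"
      by (intro L2_norm_ae_cong eL semigroup_in_L2 s generator_error_L2 h0 f)
    with C[OF generator_error_L2[OF h0 f]] show ?thesis by simp
  qed
  have "((\<lambda>h. L2_norm (?e h)) \<longlongrightarrow> 0) (at_right 0)"
  proof (rule tendsto_sandwich[OF _ _ tendsto_const])
    show "\<forall>\<^sub>F h in at_right 0. 0 \<le> L2_norm (?e h)" by simp
    show "\<forall>\<^sub>F h in at_right 0. L2_norm (?e h) \<le> C * L2_norm (generator_error T H h f)"
      using eventually_at_right_less[of "0::real"] by eventually_elim (rule le)
    show "((\<lambda>h. C * L2_norm (generator_error T H h f)) \<longlongrightarrow> 0) (at_right 0)"
      using tendsto_mult_left[OF generator_error_tendsto[OF f], of C] by simp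
  qed
  then have *: "T s f \<in> D \<and> ae_eq (\<lambda>x. - T s (H f) x) (\<lambda>x. - H (T s f) x)"
    by (rule iffD1[OF generator_iff[OF semigroup_in_L2[OF s fL(1)] g]])
  then show "T s f \<in> D" by simp
  from * show "ae_eq (H (T s f)) (T s (H f))" by (simp add: ae_eq_def eq_commute)
qed

lemma generator_error_shift:
  assumes f: "f \<in> D" and s: "0 \<le> s" and h: "0 < h"
  shows "L2_norm (generator_error T H h (T s f)) = L2_norm (T s (generator_error T H h f))"
proof (rule L2_norm_ae_cong)
  show "generator_error T H h (T s f) \<in> L2"
    by (rule generator_error_L2[OF less_imp_le[OF h] semigroup_domain(1)[OF f s]])
  show "T s (generator_error T H h f) \<in> L2"
    by (rule semigroup_in_L2[OF s generator_error_L2[OF less_imp_le[OF h] f]])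
  show "ae_eq (generator_error T H h (T s f)) (T s (generator_error T H h f))"
    using generator_error_shift_aux[OF f s h] semigroup_domain(2)[OF f s]
    unfolding ae_eq_def by eventually_elim (simp add: generator_error_def)
qed

text \<open>The first order terms \<open>- h \<langle>H u, v\<rangle>\<close> and \<open>- h \<langle>u, H v\<rangle>\<close> cancel because \<open>H\<close> is symmetric, so only the
  errors of the two expansions remain.\<close>

lemma small_time_asymmetry:
  assumes u: "u \<in> D" and v: "v \<in> D" and h: "0 < h"
  shows "cmod (L2_inner (T h u) v - L2_inner u (T h v))
     \<le> h * (L2_norm (generator_error T H h u) * L2_norm v + L2_norm u * L2_norm (generator_error T H h v))"
proof -
  let ?c = "complex_of_real h"
  let ?e = "generator_error T H h"
  note uL = domain_L2[OF u] and vL = domain_L2[OF v]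
  have eL: "?e u \<in> L2" "?e v \<in> L2" using generator_error_L2[of h] h u v by simp_all
  have expand: "T h w = (\<lambda>x. w x + (?c * ?e w x - ?c * H w x))" for w
    using h by (auto simp: generator_error_def fun_eq_iff field_simps)
  have "L2_inner (T h u) v = L2_inner u v + (?c * L2_inner (?e u) v - ?c * L2_inner (H u) v)"
    by (subst expand) (simp add: L2_inner_add_left L2_inner_diff_left L2_inner_cmult_left L2_cmult L2_diff uL vL eL)
  moreover have "L2_inner u (T h v) = L2_inner u v + (?c * L2_inner u (?e v) - ?c * L2_inner u (H v))"
    by (subst expand) (simp add: L2_inner_add_right L2_inner_diff_right L2_inner_cmult_right L2_cmult L2_diff uL vL eL)
  ultimately have "L2_inner (T h u) v - L2_inner u (T h v) = ?c * (L2_inner (?e u) v - L2_inner u (?e v))"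
    by (simp only: self_adjoint_symmetric[OF sa u v] right_diff_distrib) simp
  then have "cmod (L2_inner (T h u) v - L2_inner u (T h v)) = h * cmod (L2_inner (?e u) v - L2_inner u (?e v))"
    using h by (simp add: norm_mult)
  also have "\<dots> \<le> h * (cmod (L2_inner (?e u) v) + cmod (L2_inner u (?e v)))"
    using h by (intro mult_left_mono norm_triangle_ineq4) simp
  also have "\<dots> \<le> h * (L2_norm (?e u) * L2_norm v + L2_norm u * L2_norm (?e v))"
    using h by (intro mult_left_mono add_mono L2_inner_bound eL uL vL) simp
  finally show ?thesis .
qed

text \<open>With \<open>h = t/n\<close>, the pairings \<open>c k = \<langle>T (k h) f, T ((n - k) h) g\<rangle>\<close> interpolate between \<open>\<langle>f, T t g\<rangle>\<close> and
  \<open>\<langle>T t f, g\<rangle>\<close>.  Consecutive ones differ by the asymmetry of one step of length \<open>h\<close>, which is \<open>o(h)\<close> uniformly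
  in \<open>k\<close>: the error of the expansion at \<open>T s f\<close> is the image under \<open>T s\<close> of the error at \<open>f\<close>, and the \<open>T s\<close>
  with \<open>s \<le> t\<close> are uniformly bounded.  Hence the \<open>n\<close> differences add up to \<open>o(1)\<close>.\<close>

lemma semigroup_symmetric_domain:
  assumes b: "assumption_b T" and f: "f \<in> D" and g: "g \<in> D" and t: "0 < t"
  shows "L2_inner (T t f) g = L2_inner f (T t g)"
proof -
  obtain K where K: "K \<ge> 0"
    and bound: "\<And>s f. 0 \<le> s \<Longrightarrow> s \<le> t \<Longrightarrow> f \<in> L2 \<Longrightarrow> L2_norm (T s f) \<le> K * L2_norm f"
    using semigroup_locally_bounded[OF C0 b, of t] by metis
  note fL = domain_L2[OF f] and gL = domain_L2[OF g]
  let ?e = "generator_error T H"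
  let ?B = "\<lambda>h. L2_norm (?e h f) * L2_norm g + L2_norm f * L2_norm (?e h g)"
  have est: "cmod (L2_inner (T t f) g - L2_inner f (T t g)) \<le> t * K\<^sup>2 * ?B (t / Suc m)" for m
  proof -
    define n where "n = Suc m"
    define h where "h = t / n"
    have n: "n > 0" by (simp add: n_def)
    have h: "0 < h" and nh: "n * h = t" using t n by (simp_all add: h_def)
    define c where "c k = L2_inner (T (k * h) f) (T ((n - k) * h) g)" for k :: nat
    have step: "cmod (c (Suc k) - c k) \<le> h * K\<^sup>2 * ?B h" if k: "k < n" for k
    proof -
      let ?s = "k * h" and ?r = "(n - Suc k) * h"
      have s: "0 \<le> ?s" and r: "0 \<le> ?r" using h by simp_all
      have "?s \<le> n * h" "?r \<le> n * h"
        using h k by (intro mult_right_mono; simp)+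
      then have s_le: "?s \<le> t" and r_le: "?r \<le> t" using nh by simp_all
      note uD = semigroup_domain(1)[OF f s] and vD = semigroup_domain(1)[OF g r]
      note uL = domain_L2(1)[OF uD] and vL = domain_L2(1)[OF vD]
      have h0: "0 \<le> h" using h by simp
      have s1: "Suc k * h = h + ?s" by (simp add: algebra_simps)
      have "n - k = Suc (n - Suc k)" using k by simp
      then have r1: "(n - k) * h = h + ?r" by (simp add: algebra_simps)
      have "c (Suc k) = L2_inner (T h (T ?s f)) (T ?r g)"
        unfolding c_def s1
        by (rule L2_inner_cong[OF _ _ vL vL C0_semigroup_add[OF C0 h0 s fL(1)] ae_eq_refl])
          (intro semigroup_in_L2 h0 s fL add_nonneg_nonneg)+
      moreover have "c k = L2_inner (T ?s f) (T h (T ?r g))"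
        unfolding c_def r1
        by (rule L2_inner_cong[OF uL uL _ _ ae_eq_refl C0_semigroup_add[OF C0 h0 r gL(1)]])
          (intro semigroup_in_L2 h0 r gL add_nonneg_nonneg)+
      ultimately have "cmod (c (Suc k) - c k)
          \<le> h * (L2_norm (?e h (T ?s f)) * L2_norm (T ?r g) + L2_norm (T ?s f) * L2_norm (?e h (T ?r g)))"
        using small_time_asymmetry[OF uD vD h] by simp
      also have "\<dots> \<le> h * ((K * L2_norm (?e h f)) * (K * L2_norm g) + (K * L2_norm f) * (K * L2_norm (?e h g)))"
        unfolding generator_error_shift[OF f s h] generator_error_shift[OF g r h]
        using K h by (intro mult_left_mono add_mono mult_mono bound s r s_le r_le generator_error_L2 fL gL f g h0
            mult_nonneg_nonneg L2_norm_nonneg) simp_all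
      also have "\<dots> = h * K\<^sup>2 * ?B h" by (simp add: power2_eq_square algebra_simps)
      finally show ?thesis .
    qed
    have "cmod (c n - c 0) = cmod (\<Sum>k<n. c (Suc k) - c k)" by (simp add: sum_lessThan_telescope)
    also have "\<dots> \<le> (\<Sum>k<n. h * K\<^sup>2 * ?B h)"
      by (rule sum_norm_le) (use step in simp)
    also have "\<dots> = t * K\<^sup>2 * ?B h" by (simp add: nh[symmetric])
    finally have *: "cmod (c n - c 0) \<le> t * K\<^sup>2 * ?B h" .
    have t0: "0 \<le> t" using t by simp
    have TtL: "T t f \<in> L2" "T t g \<in> L2" by (intro semigroup_in_L2 t0 fL gL)+
    have T0L: "T 0 f \<in> L2" "T 0 g \<in> L2" by (intro semigroup_in_L2 order_refl fL gL)+
    have "c n = L2_inner (T t f) g"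
      unfolding c_def nh
      using L2_inner_cong[OF TtL(1) TtL(1) T0L(2) gL(1) ae_eq_refl C0_semigroup_0[OF C0 gL(1)]] by simp
    moreover have "c 0 = L2_inner f (T t g)"
      unfolding c_def
      using L2_inner_cong[OF T0L(1) fL(1) TtL(2) TtL(2) C0_semigroup_0[OF C0 fL(1)] ae_eq_refl] nh by simp
    ultimately show ?thesis using * by (simp add: h_def n_def)
  qed
  have "(\<lambda>m. t / Suc m) \<longlonglongrightarrow> 0"
    using tendsto_mult_left[OF LIMSEQ_inverse_real_of_nat, of t] by (simp add: field_simps)
  then have lim: "filterlim (\<lambda>m. t / Suc m) (at_right 0) sequentially"
    by (rule tendsto_imp_filterlim_at_right) (use t in simp)
  have "(\<lambda>m. t * K\<^sup>2 * ?B (t / Suc m)) \<longlonglongrightarrow> t * K\<^sup>2 * (0 * L2_norm g + L2_norm f * 0)"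
    by (intro tendsto_intros filterlim_compose[OF generator_error_tendsto lim] f g)
  then have "cmod (L2_inner (T t f) g - L2_inner f (T t g)) \<le> t * K\<^sup>2 * (0 * L2_norm g + L2_norm f * 0)"
    by (rule LIMSEQ_le_const) (use est in blast)
  then show ?thesis by simp
qed

lemma domain_approximation:
  assumes f: "f \<in> L2"
  shows "\<exists>F. (\<forall>n. F n \<in> D) \<and> (\<lambda>n. L2_norm (\<lambda>x. F n x - f x)) \<longlonglongrightarrow> 0"
proof -
  have "\<forall>n. \<exists>g\<in>D. L2_norm (\<lambda>x. f x - g x) < 1 / Suc n"
    using sa f unfolding self_adjoint_def densely_defined_def by simp
  then obtain F where F: "\<And>n. F n \<in> D" "\<And>n. L2_norm (\<lambda>x. f x - F n x) < 1 / Suc n" by metis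
  have "L2_norm (\<lambda>x. F n x - f x) < 1 / Suc n" for n
    using F(2)[of n] L2_norm_cmult[of lborel "-1" "\<lambda>x. f x - F n x"] by simp
  then have "(\<lambda>n. L2_norm (\<lambda>x. F n x - f x)) \<longlonglongrightarrow> 0"
    by (intro tendsto_sandwich[OF _ _ tendsto_const LIMSEQ_inverse_real_of_nat])
      (simp_all add: less_imp_le inverse_eq_divide)
  with F(1) show ?thesis by blast
qed

lemma semigroup_symmetric:
  assumes b: "assumption_b T" and f: "f \<in> L2" and g: "g \<in> L2" and t: "0 < t"
  shows "L2_inner (T t f) g = L2_inner f (T t g)"
proof -
  obtain F where F: "\<And>n. F n \<in> D" "(\<lambda>n. L2_norm (\<lambda>x. F n x - f x)) \<longlonglongrightarrow> 0"
    using domain_approximation[OF f] by blast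
  obtain G where G: "\<And>n. G n \<in> D" "(\<lambda>n. L2_norm (\<lambda>x. G n x - g x)) \<longlonglongrightarrow> 0"
    using domain_approximation[OF g] by blast
  have t0: "0 \<le> t" using t by simp
  note S = C0_semigroup_operator[OF C0 t0] C0_semigroup_bounded[OF C0 t0]
  note FL = domain_L2(1)[OF F(1)] and GL = domain_L2(1)[OF G(1)]
  have "(\<lambda>n. L2_inner (T t (F n)) (G n)) \<longlonglongrightarrow> L2_inner (T t f) g"
    by (rule L2_inner_tendsto[OF semigroup_in_L2[OF t0 FL] semigroup_in_L2[OF t0 f]
          L2_operator_continuous[OF S FL f F(2)] GL g G(2)])
  moreover have "(\<lambda>n. L2_inner (F n) (T t (G n))) \<longlonglongrightarrow> L2_inner f (T t g)"
    by (rule L2_inner_tendsto[OF FL f F(2) semigroup_in_L2[OF t0 GL] semigroup_in_L2[OF t0 g]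
          L2_operator_continuous[OF S GL g G(2)]])
  moreover have "L2_inner (T t (F n)) (G n) = L2_inner (F n) (T t (G n))" for n
    by (rule semigroup_symmetric_domain[OF b F(1) G(1) t])
  ultimately show ?thesis using LIMSEQ_unique by simp
qed

end

section \<open>The action on bounded functions\<close>

lemma Linf_dominated:
  assumes f: "f \<in> Linf_space M" and g: "g \<in> borel_measurable M"
    and le: "\<And>x. cmod (g x) \<le> cmod (f x)"
  shows "g \<in> Linf_space M"
proof -
  have "esssup M (\<lambda>x. ereal (cmod (g x))) \<le> esssup M (\<lambda>x. ereal (cmod (f x)))"
    by (rule esssup_mono) (use g le in auto)
  with f g show ?thesis by (auto simp: Linf_space_def)
qed

lemma Linf_one:
  "(\<lambda>x::real^'d::finite. 1) \<in> Linf" "Linf_nrm (\<lambda>x::real^'d. 1) = 1"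
proof -
  have "esssup (lborel :: (real^'d) measure) (\<lambda>x. ereal (cmod 1)) = ereal (cmod 1)"
    by (rule esssup_const) simp
  then show "(\<lambda>x::real^'d. 1) \<in> Linf" "Linf_nrm (\<lambda>x::real^'d. 1) = 1"
    by (simp_all add: Linf_space_def Linf_norm_def one_ereal_def)
qed

lemma cut_off_tendsto: "(\<lambda>n. cut_off n f x) \<longlonglongrightarrow> f x"
proof -
  obtain N :: nat where N: "norm x < N" using reals_Archimedean2 by blast
  have "\<forall>\<^sub>F n in sequentially. cut_off n f x = f x"
    using eventually_ge_at_top[of N]
    by eventually_elim (use N in \<open>simp add: cut_off_def indicator_def\<close>)
  then show ?thesis by (rule tendsto_eventually)
qed

lemma cut_off_measurable [measurable]:
  "f \<in> borel_measurable borel \<Longrightarrow> cut_off n f \<in> borel_measurable borel"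
  unfolding cut_off_def by (intro borel_measurable_times borel_measurable_indicator) simp_all

lemma cut_off_le: "cmod (cut_off n f x) \<le> cmod (f x)"
  by (simp add: cut_off_def indicator_def)

lemma cut_off_L2: "f \<in> L2 \<Longrightarrow> cut_off n f \<in> L2"
  by (rule L2_dominated(1)[of f]) (simp_all add: cut_off_le L2_iff cut_off_measurable)

lemma cut_off_one_L2: "cut_off n (\<lambda>x::real^'d::finite. 1) \<in> L2"
proof -
  have "integrable lborel (indicator (ball (0::real^'d) (real n)) :: _ \<Rightarrow> real)"
    by (intro integrable_real_indicator) (simp_all add: emeasure_lborel_ball_finite[unfolded infinity_ennreal_def])
  moreover have "(cmod (cut_off n (\<lambda>x. 1) x))\<^sup>2 = indicator (ball (0::real^'d) (real n)) x" for x
    by (simp add: cut_off_def indicator_def)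
  moreover have "cut_off n (\<lambda>x. 1) \<in> borel_measurable (borel :: (real^'d) measure)"
    by (rule cut_off_measurable) simp
  ultimately show ?thesis by (simp add: L2_iff)
qed

lemma bounded_on_Linf_convergent:
  assumes "bounded_on_Linf S" "f \<in> Linf" "\<And>x. f x \<in> \<real>\<^sub>\<ge>\<^sub>0"
  shows "AE x in lborel. convergent (\<lambda>n. S (cut_off n f) x)"
  using bspec[OF conjunct1[OF assms(1)[unfolded bounded_on_Linf_def]] assms(2)] assms(3)
  by simp

text \<open>The truncations converge to \<open>f\<close> in norm, so their images have \<open>S f\<close> as limit in norm and the monotone
  extension as limit almost everywhere.\<close>

lemma monotone_ext_L2:
  assumes S: "linear_operator L2 S" "bounded_from_to L2 L2_norm L2 L2_norm S"
    and bdd: "bounded_on_Linf S"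
    and f: "f \<in> L2" "f \<in> Linf" "\<And>x. f x \<in> \<real>\<^sub>\<ge>\<^sub>0"
  shows "AE x in lborel. monotone_ext S f x = S f x"
proof (rule L2_limit_AE_unique)
  show "S (cut_off n f) \<in> L2" for n by (rule L2_operator_in[OF S(1) cut_off_L2[OF f(1)]])
  show "S f \<in> L2" by (rule L2_operator_in[OF S(1) f(1)])
  have "(\<lambda>n. L2_norm (\<lambda>x. cut_off n f x - f x)) \<longlonglongrightarrow> 0"
    by (rule L2_dominated_convergence[OF _ f(1)])
      (use f(1) in \<open>simp_all add: cut_off_le cut_off_tendsto L2_iff cut_off_measurable\<close>)
  then show "(\<lambda>n. L2_norm (\<lambda>x. S (cut_off n f) x - S f x)) \<longlonglongrightarrow> 0"
    by (rule L2_operator_continuous[OF S cut_off_L2[OF f(1)] f(1)])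
  have "AE x in lborel. convergent (\<lambda>n. S (cut_off n f) x)"
    by (rule bounded_on_Linf_convergent[OF bdd f(2,3)])
  then show "AE x in lborel. (\<lambda>n. S (cut_off n f) x) \<longlonglongrightarrow> monotone_ext S f x"
    by eventually_elim (simp add: monotone_ext_def convergent_LIMSEQ_iff)
qed

lemma Linf_ext_L2:
  assumes S: "linear_operator L2 S" "bounded_from_to L2 L2_norm L2 L2_norm S"
    and bdd: "bounded_on_Linf S" and f: "f \<in> L2" "f \<in> Linf"
  shows "ae_eq (Linf_ext S f) (S f)"
proof -
  have [measurable]: "f \<in> borel_measurable lborel" using f(1) by (simp add: L2_iff)
  have inf: "re_pos f \<in> Linf" "re_neg f \<in> Linf" "im_pos f \<in> Linf" "im_neg f \<in> Linf"
    by (rule Linf_dominated[OF f(2)], measurable, rule cmod_parts_le)+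
  note ext = monotone_ext_L2[OF S bdd]
  have "AE x in lborel. monotone_ext S (re_pos f) x = S (re_pos f) x"
    "AE x in lborel. monotone_ext S (re_neg f) x = S (re_neg f) x"
    "AE x in lborel. monotone_ext S (im_pos f) x = S (im_pos f) x"
    "AE x in lborel. monotone_ext S (im_neg f) x = S (im_neg f) x"
    by (intro ext L2_parts inf f(1); simp)+
  with L2_operator_parts[OF S(1) f(1)] show ?thesis
    unfolding ae_eq_def Linf_ext_def by eventually_elim simp
qed

lemma Linf_ext_one_limit:
  fixes S :: "'d::finite cfun \<Rightarrow> 'd cfun"
  assumes S: "linear_operator L2 S" and bdd: "bounded_on_Linf S"
  shows "AE x in lborel. (\<lambda>n. S (cut_off n (\<lambda>y. 1)) x) \<longlonglongrightarrow> Linf_ext S (\<lambda>y. 1) x"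
proof -
  have cut: "cut_off n (\<lambda>y::real^'d. 0) = (\<lambda>y. 0)" for n by (simp add: cut_off_def fun_eq_iff)
  have "AE x in lborel. monotone_ext S (\<lambda>y. 0) x = 0"
    using L2_operator_zero[OF S] unfolding ae_eq_def monotone_ext_def
    by eventually_elim (simp add: cut)
  moreover have "AE x in lborel. convergent (\<lambda>n. S (cut_off n (\<lambda>y. 1)) x)"
    by (rule bounded_on_Linf_convergent[OF bdd Linf_one(1)]) simp
  ultimately show ?thesis
    by eventually_elim (simp add: Linf_ext_def monotone_ext_def convergent_LIMSEQ_iff)
qed

lemma assumption_cD:
  assumes "assumption_c T" "0 < t"
  shows "bounded_on_Linf (T t)"
    and "f \<in> Linf \<Longrightarrow> AE x in lborel. cmod (Linf_ext (T t) f x) \<le> Re (Linf_ext (T t) (\<lambda>y. 1) x) * Linf_nrm f"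
    and "f \<in> Linf \<Longrightarrow> Linf_ext (T t) f \<in> borel_measurable lborel"
proof -
  show b: "bounded_on_Linf (T t)"
    and "f \<in> Linf \<Longrightarrow> AE x in lborel. cmod (Linf_ext (T t) f x) \<le> Re (Linf_ext (T t) (\<lambda>y. 1) x) * Linf_nrm f"
    using assms unfolding assumption_c_def by simp_all
  assume "f \<in> Linf"
  have "bounded_from_to Linf Linf_nrm Linf Linf_nrm (Linf_ext (T t))"
    using b unfolding bounded_on_Linf_def by (rule conjunct2)
  then have "Linf_ext (T t) f \<in> Linf" by (rule bounded_from_toE) (use \<open>f \<in> Linf\<close> in blast)
  then show "Linf_ext (T t) f \<in> borel_measurable lborel" by (simp add: Linf_space_def)
qed

section \<open>Ground state domination implies intrinsic hypercontractivity\<close>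

lemma gs_measure_sets [simp, measurable_cong]: "sets (gs_measure \<phi>) = sets borel"
  by (simp add: gs_measure_def)

lemma gs_measure_measurable [simp]: "borel_measurable (gs_measure \<phi>) = borel_measurable borel"
  by (rule measurable_cong_sets) simp_all

lemma AE_gs_measure:
  assumes \<phi>: "\<phi> \<in> borel_measurable borel" and pos: "AE x in lborel. \<phi> x > 0"
  shows "(AE x in gs_measure \<phi>. P x) \<longleftrightarrow> (AE x in lborel. P x)"
proof -
  have "(AE x in gs_measure \<phi>. P x) \<longleftrightarrow> (AE x in lborel. 0 < ennreal ((\<phi> x)\<^sup>2) \<longrightarrow> P x)"
    unfolding gs_measure_def by (rule AE_density) (use \<phi> in measurable)
  also have "\<dots> \<longleftrightarrow> (AE x in lborel. P x)"
  proof
    assume "AE x in lborel. 0 < ennreal ((\<phi> x)\<^sup>2) \<longrightarrow> P x"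
    with pos show "AE x in lborel. P x"
      by eventually_elim (metis ennreal_less_zero_iff less_irrefl power2_less_0 zero_less_power2)
  qed (rule AE_mp, auto)
  finally show ?thesis .
qed

lemma gs_measure_integrable:
  fixes h :: "real^'d::finite \<Rightarrow> real"
  assumes "\<phi> \<in> borel_measurable borel" "h \<in> borel_measurable borel"
  shows "integrable (gs_measure \<phi>) h \<longleftrightarrow> integrable lborel (\<lambda>x. (\<phi> x)\<^sup>2 * h x)"
  unfolding gs_measure_def using assms by (subst integrable_density) simp_all

lemma gs_measure_integral:
  fixes h :: "real^'d::finite \<Rightarrow> real"
  assumes "\<phi> \<in> borel_measurable borel" "h \<in> borel_measurable borel"
  shows "(LINT x|gs_measure \<phi>. h x) = (LINT x|lborel. (\<phi> x)\<^sup>2 * h x)"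
  unfolding gs_measure_def using assms by (subst integral_density) simp_all

lemma gs_L2_times:
  assumes \<phi>: "\<phi> \<in> borel_measurable borel" and f: "f \<in> Lp_space (gs_measure \<phi>) 2"
  shows "(\<lambda>x. f x * complex_of_real (\<phi> x)) \<in> L2"
    and "L2_norm (\<lambda>x. f x * complex_of_real (\<phi> x)) = Lp_norm (gs_measure \<phi>) 2 f"
proof -
  have [measurable]: "\<phi> \<in> borel_measurable borel" "f \<in> borel_measurable borel"
    using \<phi> f by (simp_all add: L2_iff)
  have sq: "(cmod (f x * complex_of_real (\<phi> x)))\<^sup>2 = (\<phi> x)\<^sup>2 * (cmod (f x))\<^sup>2" for x
    by (simp add: norm_mult power_mult_distrib mult.commute)
  have "integrable (gs_measure \<phi>) (\<lambda>x. (cmod (f x))\<^sup>2)" using f by (simp add: L2_iff)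
  then have "integrable lborel (\<lambda>x. (\<phi> x)\<^sup>2 * (cmod (f x))\<^sup>2)"
    by (subst (asm) gs_measure_integrable) simp_all
  then show "(\<lambda>x. f x * complex_of_real (\<phi> x)) \<in> L2"
    unfolding L2_iff sq by simp
  show "L2_norm (\<lambda>x. f x * complex_of_real (\<phi> x)) = Lp_norm (gs_measure \<phi>) 2 f"
    unfolding L2_norm_eq sq by (subst gs_measure_integral) simp_all
qed

text \<open>Together with the preceding lemma: multiplication by \<open>\<phi>\<close> is a unitary map from the square-integrable functions
  over \<open>\<phi>\<^sup>2 dx\<close> to those over Lebesgue measure.\<close>

lemma gs_L2_divide:
  assumes \<phi>: "\<phi> \<in> borel_measurable borel" and pos: "AE x in lborel. \<phi> x > 0" and g: "g \<in> L2"
  shows "(\<lambda>x. g x / complex_of_real (\<phi> x)) \<in> Lp_space (gs_measure \<phi>) 2"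
    and "Lp_norm (gs_measure \<phi>) 2 (\<lambda>x. g x / complex_of_real (\<phi> x)) = L2_norm g"
    and "ae_eq (\<lambda>x. g x / complex_of_real (\<phi> x) * complex_of_real (\<phi> x)) g"
proof -
  have [measurable]: "\<phi> \<in> borel_measurable borel" "g \<in> borel_measurable borel"
    using \<phi> g by (simp_all add: L2_iff)
  let ?f = "\<lambda>x. g x / complex_of_real (\<phi> x)"
  show eq: "ae_eq (\<lambda>x. ?f x * complex_of_real (\<phi> x)) g"
    unfolding ae_eq_def using pos by eventually_elim simp
  have ae: "AE x in lborel. (\<phi> x)\<^sup>2 * (cmod (?f x))\<^sup>2 = (cmod (g x))\<^sup>2"
    using pos by eventually_elim (simp add: norm_divide power_divide)
  have "integrable lborel (\<lambda>x. (\<phi> x)\<^sup>2 * (cmod (?f x))\<^sup>2) \<longleftrightarrow> integrable lborel (\<lambda>x. (cmod (g x))\<^sup>2)"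
    by (rule integrable_cong_AE[OF _ _ ae]) simp_all
  then have "integrable (gs_measure \<phi>) (\<lambda>x. (cmod (?f x))\<^sup>2)"
    using g by (subst gs_measure_integrable) (simp_all add: L2_iff)
  then show f: "?f \<in> Lp_space (gs_measure \<phi>) 2" by (simp add: L2_iff)
  show "Lp_norm (gs_measure \<phi>) 2 ?f = L2_norm g"
    using gs_L2_times(2)[OF \<phi> f] L2_norm_ae_cong[OF gs_L2_times(1)[OF \<phi> f] g eq] by simp
qed

text \<open>One step of length \<open>t\<^sub>b\<close> makes the function bounded, and on bounded functions the remaining step
  is dominated by its action on the constant function.\<close>

lemma GSD_imp_gst_bounded:
  fixes T :: "real \<Rightarrow> 'd::finite cfun \<Rightarrow> 'd cfun" and \<phi> :: "real^'d \<Rightarrow> real"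
  assumes sg: "C0_semigroup T" and c: "assumption_c T" and d: "assumption_d T t\<^sub>b"
    and \<phi>: "\<phi> \<in> borel_measurable borel" and \<phi>_pos: "AE x in lborel. \<phi> x > 0"
    and s: "0 < s" and p: "0 < p" and gsd: "GSD (T s) \<phi> p"
  shows "gst_bounded T lam \<phi> (t\<^sub>b + s) p"
proof -
  have tb: "0 < t\<^sub>b" and dd: "bounded_from_to L2 L2_norm Linf Linf_nrm (T t\<^sub>b)"
    using d by (simp_all add: assumption_d_def)
  obtain C where C: "\<And>f. f \<in> L2 \<Longrightarrow> T t\<^sub>b f \<in> Linf" "\<And>f. f \<in> L2 \<Longrightarrow> Linf_nrm (T t\<^sub>b f) \<le> C * L2_norm f"
    by (rule bounded_from_toE[OF dd]) (rule that)
  have s0: "0 \<le> s" and tb0: "0 \<le> t\<^sub>b" and t0: "0 \<le> t\<^sub>b + s" using s tb by simp_all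
  note S = C0_semigroup_operator[OF sg s0] C0_semigroup_bounded[OF sg s0]
  let ?one = "Linf_ext (T s) (\<lambda>y. 1)"
  let ?R = "\<lambda>x. ?one x / complex_of_real (\<phi> x)"
  let ?G = "gs_measure \<phi>"
  let ?U = "gst_semigroup T lam \<phi> (t\<^sub>b + s)"
  define E where "E = exp (lam * (t\<^sub>b + s))"
  have R: "?R \<in> Lp_space ?G p" using gsd by (simp add: GSD_def)
  have main: "?U f \<in> Lp_space ?G p \<and> Lp_norm ?G p (?U f) \<le> (E * \<bar>C\<bar> * Lp_norm ?G p ?R) * Lp_norm ?G 2 f"
    if f: "f \<in> Lp_space ?G 2" for f
  proof -
    define g where "g = (\<lambda>x. f x * complex_of_real (\<phi> x))"
    have g: "g \<in> L2" "L2_norm g = Lp_norm ?G 2 f"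
      unfolding g_def by (rule gs_L2_times[OF \<phi> f])+
    define u where "u = T t\<^sub>b g"
    have u: "u \<in> Linf" "Linf_nrm u \<le> C * L2_norm g" unfolding u_def by (rule C[OF g(1)])+
    have u2: "u \<in> L2" unfolding u_def by (rule L2_operator_in[OF C0_semigroup_operator[OF sg tb0] g(1)])
    have Ttg: "T (t\<^sub>b + s) g \<in> L2" by (rule L2_operator_in[OF C0_semigroup_operator[OF sg t0] g(1)])
    have 1: "ae_eq (T (s + t\<^sub>b) g) (T s u)"
      unfolding u_def by (rule C0_semigroup_add[OF sg s0 tb0 g(1)])
    have 2: "ae_eq (Linf_ext (T s) u) (T s u)"
      by (rule Linf_ext_L2[OF S assumption_cD(1)[OF c s] u2 u(1)])
    have 3: "AE x in lborel. cmod (Linf_ext (T s) u x) \<le> Re (?one x) * Linf_nrm u"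
      by (rule assumption_cD(2)[OF c s u(1)])
    have 4: "AE x in lborel. cmod (?one x) \<le> Re (?one x) * Linf_nrm (\<lambda>x::real^'d. 1)"
      by (rule assumption_cD(2)[OF c s Linf_one(1)])
    let ?K = "E * \<bar>C\<bar> * L2_norm g"
    have K: "0 \<le> ?K" by (simp add: E_def)
    have "AE x in lborel. cmod (?U f x) \<le> ?K * cmod (?R x)"
      using 1 2 3 4 \<phi>_pos unfolding ae_eq_def
    proof eventually_elim
      case (elim x)
      have Re0: "0 \<le> Re (?one x)"
        using elim(4) norm_ge_zero[of "?one x"] unfolding Linf_one(2) by linarith
      have "cmod (T (t\<^sub>b + s) g x) \<le> Re (?one x) * Linf_nrm u"
        using elim by (simp add: add.commute)
      also have "\<dots> \<le> Re (?one x) * (\<bar>C\<bar> * L2_norm g)"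
        using Re0 u(2) mult_right_mono[OF abs_ge_self[of C] L2_norm_nonneg[of lborel g]]
        by (intro mult_left_mono) simp_all
      also have "\<dots> \<le> cmod (?one x) * (\<bar>C\<bar> * L2_norm g)"
        by (intro mult_right_mono complex_Re_le_cmod) simp
      finally have "E / \<phi> x * cmod (T (t\<^sub>b + s) g x) \<le> E / \<phi> x * (cmod (?one x) * (\<bar>C\<bar> * L2_norm g))"
        using elim(5) by (intro mult_left_mono) (simp_all add: E_def)
      moreover have "cmod (?U f x) = E / \<phi> x * cmod (T (t\<^sub>b + s) g x)"
        using elim(5) unfolding gst_semigroup_def g_def[symmetric] norm_mult E_def[symmetric]
        by (simp add: norm_divide E_def)
      moreover have "cmod (?R x) = cmod (?one x) / \<phi> x"
        using elim(5) by (simp add: norm_divide)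
      ultimately show ?case by (simp add: mult_ac)
    qed
    then have le: "AE x in ?G. cmod (?U f x) \<le> ?K * cmod (?R x)"
      by (simp only: AE_gs_measure[OF \<phi> \<phi>_pos])
    have [measurable]: "T (t\<^sub>b + s) g \<in> borel_measurable borel" "\<phi> \<in> borel_measurable borel"
      using Ttg \<phi> by (simp_all add: L2_iff)
    have meas: "?U f \<in> borel_measurable ?G"
      unfolding gst_semigroup_def g_def[symmetric] by simp
    from Lp_dominated[OF R meas p K le] show ?thesis by (simp add: g(2) mult_ac)
  qed
  then show ?thesis unfolding gst_bounded_def bounded_from_to_def by blast
qed

section \<open>Intrinsic hypercontractivity implies ground state domination\<close>

text \<open>For \<open>q = 1 + 1/\<delta>\<close> the conjugate exponent is \<open>1 + \<delta>\<close>, and \<open>1/\<phi>\<close> lies in the corresponding space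
  over the measure \<open>\<phi>\<^sup>2 dx\<close> exactly if \<open>\<phi>\<^sup>1\<^sup>-\<^sup>\<delta>\<close> is integrable.  So pairing with \<open>1/\<phi>\<close> turns the
  \<open>L\<^sup>q\<close> bound of the transformed semigroup into an \<open>L\<^sup>1\<close> bound of the original one.\<close>

lemma gst_bounded_imp_L1_bound:
  fixes T :: "real \<Rightarrow> 'd::finite cfun \<Rightarrow> 'd cfun" and \<phi> :: "real^'d \<Rightarrow> real"
  assumes sg: "C0_semigroup T"
    and \<phi>: "\<phi> \<in> borel_measurable borel" and \<phi>_pos: "AE x in lborel. \<phi> x > 0"
    and \<delta>: "0 < \<delta>" "\<delta> < 1" and int: "integrable lborel (\<lambda>x. \<phi> x powr (1 - \<delta>))"
    and r: "0 < r" and bd: "gst_bounded T lam \<phi> r (1 + 1 / \<delta>)"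
  shows "\<exists>K. \<forall>g\<in>L2. L2_norm g \<le> 1 \<longrightarrow>
     integrable lborel (\<lambda>x. cmod (T r g x)) \<and> (LINT x|lborel. cmod (T r g x)) \<le> K"
proof -
  let ?G = "gs_measure \<phi>"
  let ?U = "gst_semigroup T lam \<phi> r"
  define q where "q = 1 + 1 / \<delta>"
  have q: "0 < q" using \<delta> by (simp add: q_def add_pos_pos)
  obtain C where C: "\<And>f. f \<in> Lp_space ?G 2 \<Longrightarrow> ?U f \<in> Lp_space ?G q"
      "\<And>f. f \<in> Lp_space ?G 2 \<Longrightarrow> Lp_norm ?G q (?U f) \<le> C * Lp_norm ?G 2 f"
    by (rule bounded_from_toE[OF bd[unfolded gst_bounded_def, folded q_def]]) (rule that)
  define A where "A = (LINT x|lborel. \<phi> x powr (1 - \<delta>))"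
  define E where "E = exp (lam * r)"
  have E: "0 < E" by (simp add: E_def)
  have r0: "0 \<le> r" using r by simp
  note S = C0_semigroup_operator[OF sg r0]
  have main: "integrable lborel (\<lambda>x. cmod (T r g x)) \<and> (LINT x|lborel. cmod (T r g x)) \<le> (A + \<bar>C\<bar> powr q) / E"
    if g: "g \<in> L2" "L2_norm g \<le> 1" for g
  proof -
    define f where "f = (\<lambda>x. g x / complex_of_real (\<phi> x))"
    have D: "f \<in> Lp_space ?G 2" "Lp_norm ?G 2 f = L2_norm g"
      "ae_eq (\<lambda>x. f x * complex_of_real (\<phi> x)) g"
      unfolding f_def by (rule gs_L2_divide[OF \<phi> \<phi>_pos g(1)])+
    define u where "u = ?U f"
    have u: "u \<in> Lp_space ?G q" "Lp_norm ?G q u \<le> C * Lp_norm ?G 2 f"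
      unfolding u_def by (rule C[OF D(1)])+
    have [measurable]: "u \<in> borel_measurable borel" "\<phi> \<in> borel_measurable borel" "T r g \<in> borel_measurable borel"
      using u(1) \<phi> L2_operator_in[OF S g(1)] by (simp_all add: Lp_space_def)
    have intu: "integrable lborel (\<lambda>x. (\<phi> x)\<^sup>2 * cmod (u x) powr q)"
      using u(1) by (subst gs_measure_integrable[symmetric]) (simp_all add: Lp_space_def)
    define J where "J = (LINT x|lborel. (\<phi> x)\<^sup>2 * cmod (u x) powr q)"
    have J0: "0 \<le> J" unfolding J_def by (rule integral_nonneg_AE) simp
    have "J powr (1 / q) = Lp_norm ?G q u"
      unfolding J_def Lp_norm_def by (subst gs_measure_integral) simp_all
    also have "\<dots> \<le> \<bar>C\<bar> * L2_norm g"
      using u(2) D(2) mult_right_mono[OF abs_ge_self[of C] L2_norm_nonneg[of lborel g]] by simp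
    also have "\<dots> \<le> \<bar>C\<bar>" using g(2) mult_left_mono[OF g(2), of "\<bar>C\<bar>"] by simp
    finally have "(J powr (1 / q)) powr q \<le> \<bar>C\<bar> powr q"
      using q by (intro powr_mono2) simp_all
    then have J: "J \<le> \<bar>C\<bar> powr q" using q J0 by (simp add: powr_powr)
    have eq: "ae_eq (T r (\<lambda>x. f x * complex_of_real (\<phi> x))) (T r g)"
      by (rule L2_operator_cong[OF S gs_L2_times(1)[OF \<phi> D(1)] g(1) D(3)])
    have le: "AE x in lborel. cmod (T r g x) \<le> (\<phi> x powr (1 - \<delta>) + (\<phi> x)\<^sup>2 * cmod (u x) powr q) / E"
      using eq \<phi>_pos unfolding ae_eq_def
    proof eventually_elim
      case (elim x)
      let ?a = "\<phi> x" and ?y = "cmod (u x)"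
      have "?y = E / ?a * cmod (T r g x)"
        using elim unfolding u_def gst_semigroup_def E_def[symmetric] norm_mult
        by (simp add: norm_divide E_def)
      then have w: "cmod (T r g x) = ?a * ?y / E" using elim E by simp
      have "?a * ?y \<le> ?a powr (1 - \<delta>) + ?a\<^sup>2 * ?y powr q"
        \<comment> \<open>Young's inequality for \<open>1/?a\<close> and \<open>?y\<close>, without its constants: if \<open>?y\<close> exceeds \<open>?a\<close> to the power
          \<open>-\<delta>\<close>, the second summand dominates, otherwise the first.\<close>
      proof (cases "?y \<le> ?a powr (- \<delta>)")
        case True
        then have "?a * ?y \<le> ?a * ?a powr (- \<delta>)" using elim by simp
        also have "\<dots> = ?a powr (1 - \<delta>)" using elim by (simp add: powr_diff powr_minus divide_inverse)
        finally show ?thesis by (simp add: add_increasing2)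
      next
        case False
        then have y: "?a powr (- \<delta>) < ?y" by simp
        then have y0: "0 < ?y" using powr_ge_zero[of ?a "- \<delta>"] by linarith
        have "(?a powr (- \<delta>)) powr (1 / \<delta>) \<le> ?y powr (1 / \<delta>)"
          using y \<delta> by (intro powr_mono2) simp_all
        moreover have "(?a powr (- \<delta>)) powr (1 / \<delta>) = 1 / ?a"
          using \<delta> elim unfolding powr_powr by (simp add: powr_minus_divide)
        ultimately have "1 / ?a \<le> ?y powr (1 / \<delta>)" by simp
        then have "?a\<^sup>2 * ?y * (1 / ?a) \<le> ?a\<^sup>2 * ?y * ?y powr (1 / \<delta>)"
          using y0 by (intro mult_left_mono) simp_all
        then have "?a * ?y \<le> ?a\<^sup>2 * ?y powr q"
          using y0 elim by (simp add: q_def powr_add power2_eq_square mult_ac)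
        then show ?thesis by (simp add: add_increasing)
      qed
      then show ?case unfolding w using E by (simp add: divide_right_mono)
    qed
    have intsum: "integrable lborel (\<lambda>x. (\<phi> x powr (1 - \<delta>) + (\<phi> x)\<^sup>2 * cmod (u x) powr q) / E)"
      using int intu by simp
    have int1: "integrable lborel (\<lambda>x. cmod (T r g x))"
    proof (rule Bochner_Integration.integrable_bound[OF intsum])
      show "AE x in lborel. norm (cmod (T r g x)) \<le> norm ((\<phi> x powr (1 - \<delta>) + (\<phi> x)\<^sup>2 * cmod (u x) powr q) / E)"
        using le
      proof eventually_elim
        case (elim x)
        then show ?case by (simp only: real_norm_def abs_norm_cancel)
      qed
    qed simp
    have "(LINT x|lborel. cmod (T r g x)) \<le> (LINT x|lborel. (\<phi> x powr (1 - \<delta>) + (\<phi> x)\<^sup>2 * cmod (u x) powr q) / E)"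
      by (rule integral_mono_AE[OF int1 intsum le])
    also have "\<dots> = (A + J) / E" using int intu by (simp add: A_def J_def)
    also have "\<dots> \<le> (A + \<bar>C\<bar> powr q) / E" using J E by (simp add: divide_right_mono)
    finally show ?thesis using int1 by simp
  qed
  then show ?thesis by blast
qed

text \<open>With \<open>B\<close> the truncation of the constant function, symmetry gives \<open>\<parallel>S B\<parallel>\<^sup>2 = \<langle>B, S (S B)\<rangle>\<close>.  As \<open>0 \<le> B \<le> 1\<close>,
  this is at most the \<open>L\<^sup>1\<close> norm of \<open>S (S B)\<close>, hence at most \<open>K \<parallel>S B\<parallel>\<close>: the bound does not depend on \<open>n\<close>.\<close>

lemma cut_off_one_bound:
  fixes S :: "'d::finite cfun \<Rightarrow> 'd cfun"
  assumes S: "linear_operator L2 S"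
    and sym: "\<And>f g. f \<in> L2 \<Longrightarrow> g \<in> L2 \<Longrightarrow> L2_inner (S f) g = L2_inner f (S g)"
    and K: "\<And>g. g \<in> L2 \<Longrightarrow> L2_norm g \<le> 1 \<Longrightarrow>
       integrable lborel (\<lambda>x. cmod (S g x)) \<and> (LINT x|lborel. cmod (S g x)) \<le> K"
  shows "L2_norm (S (cut_off n (\<lambda>x. 1))) \<le> max K 0"
proof (cases "L2_norm (S (cut_off n (\<lambda>x. 1))) = 0")
  case False
  define B where "B = cut_off n (\<lambda>x::real^'d. 1)"
  define N where "N = L2_norm (S B)"
  have N: "0 < N" using False L2_norm_nonneg[of lborel "S B"] unfolding N_def B_def by linarith
  have B: "B \<in> L2" unfolding B_def by (rule cut_off_one_L2)
  have TB: "S B \<in> L2" by (rule L2_operator_in[OF S B])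
  define h where "h = (\<lambda>x. complex_of_real (1 / N) * S B x)"
  have h: "h \<in> L2" unfolding h_def by (rule L2_cmult[OF TB])
  have h1: "L2_norm h = 1" using N unfolding h_def L2_norm_cmult norm_of_real N_def[symmetric] by simp
  have Th: "S h \<in> L2" by (rule L2_operator_in[OF S h])
  have "L2_inner (S B) (S B) = complex_of_real (N\<^sup>2)"
    unfolding L2_inner_def N_def L2_norm_sq by (simp add: complex_norm_square[symmetric] flip: of_real_power)
  then have "complex_of_real N = L2_inner (S B) h"
    using N unfolding h_def L2_inner_cmult_right by (simp add: power2_eq_square)
  also have "\<dots> = L2_inner B (S h)" by (rule sym[OF B h])
  finally have "N = cmod (L2_inner B (S h))" using N by (metis abs_of_pos norm_of_real)
  also have "\<dots> \<le> (LINT x|lborel. cmod (B x * cnj (S h x)))"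
    unfolding L2_inner_def by (rule integral_norm_bound)
  also have "\<dots> \<le> (LINT x|lborel. cmod (S h x))"
  proof (rule integral_mono)
    show "integrable lborel (\<lambda>x. cmod (B x * cnj (S h x)))"
      using L2_inner_integrable[OF B Th] by (rule integrable_norm)
    show "integrable lborel (\<lambda>x. cmod (S h x))" using K[OF h] h1 by simp
    show "cmod (B x * cnj (S h x)) \<le> cmod (S h x)" for x
      by (simp add: B_def cut_off_def indicator_def)
  qed
  also have "\<dots> \<le> K" using K[OF h] h1 by simp
  finally show ?thesis by (simp add: N_def B_def)
qed simp

text \<open>Fatou's lemma, applied to the truncations of the constant function.\<close>

lemma one_in_L2:
  fixes S :: "'d::finite cfun \<Rightarrow> 'd cfun"
  assumes S: "linear_operator L2 S" and bdd: "bounded_on_Linf S"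
    and G: "Linf_ext S (\<lambda>x. 1) \<in> borel_measurable borel" and bound: "\<And>n. L2_norm (S (cut_off n (\<lambda>x. 1))) \<le> K"
  shows "Linf_ext S (\<lambda>x. 1) \<in> L2"
proof -
  define F where "F n = S (cut_off n (\<lambda>x. 1))" for n
  let ?one = "Linf_ext S (\<lambda>x. 1)"
  have F: "F n \<in> L2" "L2_norm (F n) \<le> K" for n
    unfolding F_def by (rule L2_operator_in[OF S cut_off_one_L2], rule bound)
  have [measurable]: "?one \<in> borel_measurable lborel" "\<And>n. F n \<in> borel_measurable lborel"
    using G F(1) by (simp_all add: L2_iff)
  have lim: "AE x in lborel. (\<lambda>n. F n x) \<longlonglongrightarrow> ?one x"
    unfolding F_def by (rule Linf_ext_one_limit[OF S bdd])
  have "(\<integral>\<^sup>+x. ennreal ((cmod (?one x))\<^sup>2) \<partial>lborel) = (\<integral>\<^sup>+x. liminf (\<lambda>n. ennreal ((cmod (F n x))\<^sup>2)) \<partial>lborel)"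
  proof (rule nn_integral_cong_AE)
    show "AE x in lborel. ennreal ((cmod (?one x))\<^sup>2) = liminf (\<lambda>n. ennreal ((cmod (F n x))\<^sup>2))"
      using lim
    proof eventually_elim
      case (elim x)
      have "(\<lambda>n. ennreal ((cmod (F n x))\<^sup>2)) \<longlonglongrightarrow> ennreal ((cmod (?one x))\<^sup>2)"
        by (intro tendsto_ennrealI tendsto_power tendsto_norm elim)
      then show ?case by (intro lim_imp_Liminf[symmetric]) simp_all
    qed
  qed
  also have "\<dots> \<le> liminf (\<lambda>n. \<integral>\<^sup>+x. ennreal ((cmod (F n x))\<^sup>2) \<partial>lborel)"
    by (rule nn_integral_liminf) measurable
  also have "\<dots> \<le> liminf (\<lambda>n. ennreal (K\<^sup>2))"
    using F by (intro Liminf_mono always_eventually allI)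
      (simp add: nn_integral_L2_norm power_mono)
  also have "\<dots> = ennreal (K\<^sup>2)" by (rule Liminf_const) simp
  also have "\<dots> < \<infinity>" by simp
  finally have "integrable lborel (\<lambda>x. (cmod (?one x))\<^sup>2)"
    by (intro integrableI_nonneg) simp_all
  then show ?thesis by (simp add: L2_iff)
qed

text \<open>The semigroup law holds for every truncation of the constant function.  It passes to the limit because \<open>T r\<close> of
  the truncations increases to a square-integrable function, hence converges in norm, where \<open>T s\<close> is continuous.\<close>

lemma one_factorization:
  fixes T :: "real \<Rightarrow> 'd::finite cfun \<Rightarrow> 'd cfun"
  assumes sg: "C0_semigroup T" and b: "assumption_b T" and c: "assumption_c T"
    and s: "0 < s" and r: "0 < r" and G: "Linf_ext (T r) (\<lambda>x. 1) \<in> L2"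
  shows "ae_eq (Linf_ext (T (s + r)) (\<lambda>x. 1)) (T s (Linf_ext (T r) (\<lambda>x. 1)))"
proof -
  have nn: "0 \<le> s" "0 \<le> r" "0 \<le> s + r" "0 < s + r" using s r by simp_all
  note Ss = C0_semigroup_operator[OF sg nn(1)] C0_semigroup_bounded[OF sg nn(1)]
  note Sr = C0_semigroup_operator[OF sg nn(2)]
  have pos: "positivity_improving (T r)" using b r by (simp add: assumption_b_def)
  let ?G = "Linf_ext (T r) (\<lambda>x. 1)"
  define B where "B n = cut_off n (\<lambda>x::real^'d. 1)" for n
  define F where "F n = T r (B n)" for n
  have B: "B n \<in> L2" for n unfolding B_def by (rule cut_off_one_L2)
  have F: "F n \<in> L2" for n unfolding F_def by (rule L2_operator_in[OF Sr B])
  have lim: "AE x in lborel. (\<lambda>n. F n x) \<longlonglongrightarrow> ?G x"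
    unfolding F_def B_def by (rule Linf_ext_one_limit[OF Sr assumption_cD(1)[OF c r]])
  have mono: "AE x in lborel. cmod (F n x) \<le> cmod (F m x)" if "n \<le> m" for n m
  proof -
    have "B n x \<in> \<real>\<^sub>\<ge>\<^sub>0" "B m x - B n x \<in> \<real>\<^sub>\<ge>\<^sub>0" for x
      using that by (auto simp: B_def cut_off_def indicator_def)
    then show ?thesis
      unfolding F_def by (intro positive_operator_mono[OF Sr pos B _ B]) simp_all
  qed
  have le: "AE x in lborel. cmod (F n x) \<le> cmod (?G x)" for n
  proof -
    have "AE x in lborel. \<forall>m. n \<le> m \<longrightarrow> cmod (F n x) \<le> cmod (F m x)"
      using mono by (simp add: AE_all_countable)
    with lim show ?thesis
    proof eventually_elim
      case (elim x)
      show ?case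
        by (rule LIMSEQ_le_const[OF tendsto_norm[OF elim(1)]]) (use elim(2) in blast)
    qed
  qed
  have Fm: "F n \<in> borel_measurable lborel" for n using F by (simp add: L2_iff)
  have "(\<lambda>n. L2_norm (\<lambda>x. F n x - ?G x)) \<longlonglongrightarrow> 0"
    by (rule L2_dominated_convergence[OF Fm G le lim])
  then have conv: "(\<lambda>n. L2_norm (\<lambda>x. T s (F n) x - T s ?G x)) \<longlonglongrightarrow> 0"
    by (rule L2_operator_continuous[OF Ss F G])
  have "AE x in lborel. \<forall>n. T (s + r) (B n) x = T s (F n) x"
    using C0_semigroup_add[OF sg nn(1,2) B] unfolding F_def ae_eq_def by (simp add: AE_all_countable)
  with Linf_ext_one_limit[OF C0_semigroup_operator[OF sg nn(3)] assumption_cD(1)[OF c nn(4)]]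
  have "AE x in lborel. (\<lambda>n. T s (F n) x) \<longlonglongrightarrow> Linf_ext (T (s + r)) (\<lambda>x. 1) x"
    by eventually_elim (simp add: B_def)
  from L2_limit_AE_unique[OF L2_operator_in[OF Ss(1) F] L2_operator_in[OF Ss(1) G] conv this]
  show ?thesis by (simp add: ae_eq_def)
qed

text \<open>The step of length \<open>r\<close> takes the constant function into the square-integrable functions; its image divided by
  \<open>\<phi>\<close> is then square-integrable over \<open>\<phi>\<^sup>2 dx\<close>, and the step of length \<open>s\<close> improves it to \<open>L\<^sup>p\<close>.\<close>

lemma gst_bounded_imp_GSD:
  fixes T :: "real \<Rightarrow> 'd::finite cfun \<Rightarrow> 'd cfun" and \<phi> :: "real^'d \<Rightarrow> real"
  assumes sg: "C0_semigroup T" and b: "assumption_b T" and c: "assumption_c T"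
    and \<phi>: "\<phi> \<in> borel_measurable borel" and \<phi>_pos: "AE x in lborel. \<phi> x > 0"
    and sym: "\<And>f g. f \<in> L2 \<Longrightarrow> g \<in> L2 \<Longrightarrow> L2_inner (T r f) g = L2_inner f (T r g)"
    and \<delta>: "0 < \<delta>" "\<delta> < 1" and int: "integrable lborel (\<lambda>x. \<phi> x powr (1 - \<delta>))"
    and s: "0 < s" and r: "0 < r" and p: "0 < p"
    and bd_r: "gst_bounded T lam \<phi> r (1 + 1 / \<delta>)" and bd_s: "gst_bounded T lam \<phi> s p"
  shows "GSD (T (s + r)) \<phi> p"
proof -
  obtain K where K: "\<forall>g\<in>L2. L2_norm g \<le> 1 \<longrightarrow>
     integrable lborel (\<lambda>x. cmod (T r g x)) \<and> (LINT x|lborel. cmod (T r g x)) \<le> K"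
    using gst_bounded_imp_L1_bound[OF sg \<phi> \<phi>_pos \<delta> int r bd_r] by (rule exE)
  let ?G = "Linf_ext (T r) (\<lambda>x. 1)"
  let ?one = "Linf_ext (T (s + r)) (\<lambda>x. 1)"
  let ?U = "gst_semigroup T lam \<phi> s"
  have r0: "0 \<le> r" using r by simp
  note Sr = C0_semigroup_operator[OF sg r0]
  have "L2_norm (T r (cut_off n (\<lambda>x. 1))) \<le> max K 0" for n
    by (rule cut_off_one_bound[OF Sr sym]) (use K in simp_all)
  then have G: "?G \<in> L2"
    by (rule one_in_L2[OF Sr assumption_cD(1)[OF c r] assumption_cD(3)[OF c r Linf_one(1), simplified]])
  define f where "f = (\<lambda>x. ?G x / complex_of_real (\<phi> x))"
  have Df: "f \<in> Lp_space (gs_measure \<phi>) 2" "ae_eq (\<lambda>x. f x * complex_of_real (\<phi> x)) ?G"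
    unfolding f_def by (rule gs_L2_divide[OF \<phi> \<phi>_pos G])+
  have s0: "0 \<le> s" and sr: "0 < s + r" using s r by simp_all
  note S = C0_semigroup_operator[OF sg s0]
  have U: "?U f \<in> Lp_space (gs_measure \<phi>) p"
    by (rule bounded_from_toE[OF bd_s[unfolded gst_bounded_def]]) (use Df(1) in blast)
  have "ae_eq (T s (\<lambda>x. f x * complex_of_real (\<phi> x))) (T s ?G)"
    by (rule L2_operator_cong[OF S gs_L2_times(1)[OF \<phi> Df(1)] G Df(2)])
  with one_factorization[OF sg b c s r G] \<phi>_pos
  have "AE x in lborel. cmod (?one x / complex_of_real (\<phi> x)) \<le> exp (- lam * s) * cmod (?U f x)"
    unfolding ae_eq_def
    by eventually_elim
      (simp add: gst_semigroup_def norm_mult norm_divide exp_minus field_simps)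
  then have "AE x in gs_measure \<phi>. cmod (?one x / complex_of_real (\<phi> x)) \<le> exp (- lam * s) * cmod (?U f x)"
    by (simp only: AE_gs_measure[OF \<phi> \<phi>_pos])
  moreover have "(\<lambda>x. ?one x / complex_of_real (\<phi> x)) \<in> borel_measurable (gs_measure \<phi>)"
    using assumption_cD(3)[OF c sr Linf_one(1)] \<phi> by simp
  ultimately have "(\<lambda>x. ?one x / complex_of_real (\<phi> x)) \<in> Lp_space (gs_measure \<phi>) p"
    by (intro Lp_dominated(1)[OF U _ p, of _ "exp (- lam * s)"]) simp_all
  then show ?thesis by (simp add: GSD_def)
qed

lemma ground_state_measurable:
  assumes "self_adjoint D H" "ground_state D H \<phi>"
  shows "\<phi> \<in> borel_measurable borel"
proof -
  have "(\<lambda>x. complex_of_real (\<phi> x)) \<in> D" using assms(2) by (simp add: ground_state_def eigenspace_def)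
  then have "(\<lambda>x. complex_of_real (\<phi> x)) \<in> L2"
    using assms(1) linear_operatorD(1) unfolding self_adjoint_def by blast
  then have "(\<lambda>x. complex_of_real (\<phi> x)) \<in> borel_measurable borel" by (simp add: L2_iff)
  then have "(\<lambda>x. Re (complex_of_real (\<phi> x))) \<in> borel_measurable borel" by measurable
  then show ?thesis by simp
qed

theorem theorem2p1:
  fixes D :: "(real^'d::finite \<Rightarrow> complex) set"
    and H :: "(real^'d \<Rightarrow> complex) \<Rightarrow> (real^'d \<Rightarrow> complex)"
    and T :: "real \<Rightarrow> (real^'d \<Rightarrow> complex) \<Rightarrow> (real^'d \<Rightarrow> complex)"
    and \<phi>\<^sub>0 :: "real^'d \<Rightarrow> real"
    and lam0 t\<^sub>b :: real
  assumes "self_adjoint D H" and "bounded_from_below D H"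
    and "exp_semigroup D H T"
    and "lam0 = inf_spectrum D H"
    and "assumption_a D H"
    and "assumption_b T"
    and "assumption_c T"
    and "assumption_d T t\<^sub>b"
    and "ground_state D H \<phi>\<^sub>0"
  shows
    "((IHC T lam0 \<phi>\<^sub>0 \<and> (\<exists>\<delta>\<in>{0<..<1}. integrable lborel (\<lambda>x. \<phi>\<^sub>0 x powr (1 - \<delta>)))
        \<longrightarrow> (\<forall>p>2. AGSD T \<phi>\<^sub>0 p)) \<and>
      (\<forall>\<delta>\<in>{0<..<1}. integrable lborel (\<lambda>x. \<phi>\<^sub>0 x powr (1 - \<delta>)) \<longrightarrow>
        (\<forall>\<tau> :: real \<Rightarrow> real.
           (\<forall>p>2. \<tau> p > 0 \<and> (\<forall>t\<ge>\<tau> p. gst_bounded T lam0 \<phi>\<^sub>0 t p)) \<longrightarrow>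
           (\<forall>p>2. AGSD_from T \<phi>\<^sub>0 (2 * max (\<tau> p) (\<tau> (1 + 1 / \<delta>))) p))))
     \<and>
     (((\<forall>p>2. AGSD T \<phi>\<^sub>0 p) \<longrightarrow> IHC T lam0 \<phi>\<^sub>0) \<and>
      (\<forall>\<tau> :: real \<Rightarrow> real.
         (\<forall>p>2. \<tau> p > 0 \<and> (\<forall>t\<ge>\<tau> p. GSD (T t) \<phi>\<^sub>0 p)) \<longrightarrow>
         (\<forall>p>2. \<forall>t\<ge>t\<^sub>b + \<tau> p. gst_bounded T lam0 \<phi>\<^sub>0 t p)))"
proof -
  note sa = assms(1) and es = assms(3) and b = assms(6) and c = assms(7) and d = assms(8)
  have sg: "C0_semigroup T" by (rule exp_semigroup_C0[OF es])
  have \<phi>: "\<phi>\<^sub>0 \<in> borel_measurable borel" by (rule ground_state_measurable[OF sa assms(9)])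
  have pos: "AE x in lborel. \<phi>\<^sub>0 x > 0" using assms(9) by (simp add: ground_state_def)
  have domination: "AGSD_from T \<phi>\<^sub>0 (2 * max (\<tau> p) (\<tau> (1 + 1 / \<delta>))) p"
    if \<delta>: "\<delta> \<in> {0<..<1}" and int: "integrable lborel (\<lambda>x. \<phi>\<^sub>0 x powr (1 - \<delta>))"
      and \<tau>: "\<forall>p>2. \<tau> p > 0 \<and> (\<forall>t\<ge>\<tau> p. gst_bounded T lam0 \<phi>\<^sub>0 t p)" and p: "p > 2" for \<delta> \<tau> p
  proof -
    have \<delta>': "0 < \<delta>" "\<delta> < 1" using \<delta> by auto
    let ?q = "1 + 1 / \<delta>"
    have q: "?q > 2" using \<delta>' by (simp add: field_simps)
    have \<tau>_pos: "\<tau> p > 0" "\<tau> ?q > 0" using \<tau> p q by blast+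
    have "GSD (T t) \<phi>\<^sub>0 p" if t: "t > 2 * max (\<tau> p) (\<tau> ?q)" for t
    proof -
      have half: "0 < t / 2" "\<tau> p \<le> t / 2" "\<tau> ?q \<le> t / 2" using t \<tau>_pos by auto
      have "GSD (T (t / 2 + t / 2)) \<phi>\<^sub>0 p"
      proof (rule gst_bounded_imp_GSD[OF sg b c \<phi> pos _ \<delta>' int half(1) half(1)])
        show "L2_inner (T (t / 2) f) g = L2_inner f (T (t / 2) g)" if "f \<in> L2" "g \<in> L2" for f g
          by (rule semigroup_symmetric[OF sa es b that half(1)])
        show "gst_bounded T lam0 \<phi>\<^sub>0 (t / 2) ?q" "gst_bounded T lam0 \<phi>\<^sub>0 (t / 2) p" "0 < p"
          using \<tau> p q half by auto
      qed
      then show ?thesis by simp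
    qed
    with \<tau>_pos show ?thesis by (auto simp: AGSD_from_def)
  qed
  have hyper: "gst_bounded T lam0 \<phi>\<^sub>0 t p"
    if \<tau>: "\<tau> > 0" "\<forall>t\<ge>\<tau>. GSD (T t) \<phi>\<^sub>0 p" and p: "p > 2" and t: "t \<ge> t\<^sub>b + \<tau>" for \<tau> p t :: real
  proof -
    have s: "0 < t - t\<^sub>b" "\<tau> \<le> t - t\<^sub>b" and p0: "0 < p" using \<tau> t p by auto
    have "gst_bounded T lam0 \<phi>\<^sub>0 (t\<^sub>b + (t - t\<^sub>b)) p"
      by (rule GSD_imp_gst_bounded[OF sg c d \<phi> pos s(1) p0]) (use \<tau>(2) s(2) in blast)
    then show ?thesis by simp
  qed
  have "AGSD T \<phi>\<^sub>0 p"
    if ihc: "IHC T lam0 \<phi>\<^sub>0" and \<delta>: "\<delta> \<in> {0<..<1}" "integrable lborel (\<lambda>x. \<phi>\<^sub>0 x powr (1 - \<delta>))"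
      and p: "p > 2" for \<delta> p
  proof -
    have "\<forall>p. \<exists>t\<^sub>p. p > 2 \<longrightarrow> t\<^sub>p > 0 \<and> (\<forall>t\<ge>t\<^sub>p. gst_bounded T lam0 \<phi>\<^sub>0 t p)"
      using ihc unfolding IHC_def by blast
    then obtain \<tau> where "\<forall>p>2. \<tau> p > 0 \<and> (\<forall>t\<ge>\<tau> p. gst_bounded T lam0 \<phi>\<^sub>0 t p)"
      by (rule choice[THEN exE])
    from domination[OF \<delta> this p] show ?thesis unfolding AGSD_def by blast
  qed
  moreover have "IHC T lam0 \<phi>\<^sub>0" if agsd: "\<forall>p>2. AGSD T \<phi>\<^sub>0 p"
    unfolding IHC_def
  proof (intro allI impI)
    fix p :: real assume p: "2 < p"
    then obtain t\<^sub>p where tp: "t\<^sub>p > 0" "\<forall>t>t\<^sub>p. GSD (T t) \<phi>\<^sub>0 p"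
      using agsd unfolding AGSD_def AGSD_from_def by blast
    have "t\<^sub>b > 0" using d by (simp add: assumption_d_def)
    moreover have "\<forall>t\<ge>t\<^sub>b + (t\<^sub>p + 1). gst_bounded T lam0 \<phi>\<^sub>0 t p"
      using hyper[of "t\<^sub>p + 1" p] tp p by simp
    ultimately show "\<exists>t\<^sub>p>0. \<forall>t\<ge>t\<^sub>p. gst_bounded T lam0 \<phi>\<^sub>0 t p"
      using tp(1) by (intro exI[of _ "t\<^sub>b + (t\<^sub>p + 1)"]) simp
  qed
  ultimately show ?thesis using domination hyper by blast
qed

end
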